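(* Let $n\in\mathbb{N}$, $n\ge 1$, $0<\tau\le\infty$, $k\in L^1_{loc}([0,(n+1)\tau))$, and let $(S_k(t))_{t\in[0,\tau)}$ be a non-degenerate local $k$-convoluted semigroup on a Banach space $X$ generated by a closed operator $A$. Let $0<\kappa<\tau$. Put $S_{k^{\ast 1}}:=S_k$, and define families $(S_{k^{\ast (m+1)}}(t))_{t\in[0,(m+1)\kappa]}$ recursively for $m=1,\dots,n$ by $$S_{k^{\ast (m+1)}}(t)x=\int_0^t k(t-s)S_{k^{\ast m}}(s)x\,ds,\qquad x\in X,\ t\in[0,m\kappa],$$ and $$S_{k^{\ast (m+1)}}(t)x=S_{k^{\ast m}}(m\kappa)S_k(t-m\kappa)x+\int_0^{m\kappa}k(t-s)S_{k^{\ast m}}(s)x\,ds+\int_0^{t-m\kappa}k^{\ast m}(t-s)S_k(s)x\,ds$$ for $x\in X$ and $t\in[m\kappa,(m+1)\kappa]$. Then $(S_{k^{\ast (n+1)}}(t))_{t\in[0,(n+1)\kappa]}$ is a local $k^{\ast (n+1)}$-convoluted semigroup generated by $A$, for any $\kappa<\tau$. Consequently $A$ generates a local $k^{\ast (n+1)}$-convoluted semigroup $(S_{k^{\ast (n+1)}}(t))_{t\in[0,(n+1)\tau)}$.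
   Context: Convolution: $(f\ast g)(t)=\int_0^t f(t-s)g(s)\,ds$; $k^{\ast 1}=k$ and $k^{\ast m}=k\ast k^{\ast(m-1)}$ for $m\ge 2$. Local $k$-convoluted semigroup: let $I$ be an interval $[0,\sigma)$ with $0<\sigma\le\infty$ (or $[0,\sigma]$ with $0<\sigma<\infty$), $k$ a scalar locally integrable function on $I$, and $A$ a closed linear operator on the Banach space $X$ with domain $D(A)$. A strongly continuous family $(S_k(t))_{t\in I}$ of bounded linear operators on $X$ is a local $k$-convoluted semigroup (also called local $k$-semigroup) generated by $A$ if, for all $t\in I$ and $x\in X$: $S_k(t)A\subset AS_k(t)$; $\int_0^t S_k(s)x\,ds\in D(A)$; and $$A\int_0^t S_k(s)x\,ds=S_k(t)x-\int_0^t k(s)\,ds\;x .$$ It is non-degenerate if $S_k(t)x=0$ for all $t\in I$ implies $x=0$. *)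

theory Defs
  imports "HOL-Analysis.Analysis"
begin

text \<open>
  The sort \<open>{real_normed_field, euclidean_space}\<close> comprises the two scalar fields, the reals and the
  complex numbers. Class \<open>banach\<close> only provides real scalars, so the scalar multiplication is an
  explicit parameter, required to extend \<open>scaleR\<close>.
\<close>

locale banach_space_over = vector_space smul
  for smul :: "'s::{real_normed_field, euclidean_space} \<Rightarrow> 'a::banach \<Rightarrow> 'a" +
  assumes smul_of_real: "smul (of_real r) x = r *\<^sub>R x"
    and norm_smul: "norm (smul c x) = norm c * norm x"

lemma banach_space_over_scaleR:
  "banach_space_over (scaleR :: real \<Rightarrow> 'a::banach \<Rightarrow> 'a)"
  by unfold_locales (simp_all add: algebra_simps)

lemma banach_space_over_complex:
  "banach_space_over ((*) :: complex \<Rightarrow> complex \<Rightarrow> complex)"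
  by unfold_locales (simp_all add: algebra_simps norm_mult scaleR_conv_of_real)

definition Ico :: "ereal \<Rightarrow> real set" where
  "Ico \<sigma> = {t. 0 \<le> t \<and> ereal t < \<sigma>}"

definition time_interval :: "real set \<Rightarrow> bool" where
  "time_interval I \<longleftrightarrow> (\<exists>\<sigma>>0. I = Ico \<sigma>) \<or> (\<exists>\<sigma>>0. I = {0..\<sigma>})"

definition locally_integrable_on :: "(real \<Rightarrow> 's::euclidean_space) \<Rightarrow> real set \<Rightarrow> bool" where
  "locally_integrable_on k I \<longleftrightarrow> (\<forall>K. compact K \<and> K \<subseteq> I \<longrightarrow> k absolutely_integrable_on K)"

text \<open>
  An operator is a pair of a domain \<open>D\<close> and a total function \<open>A\<close> whose values outside \<open>D\<close> are irrelevant.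
\<close>

definition closed_linear_operator ::
    "('s::field \<Rightarrow> 'a::real_normed_vector \<Rightarrow> 'a) \<Rightarrow> 'a set \<Rightarrow> ('a \<Rightarrow> 'a) \<Rightarrow> bool" where
  "closed_linear_operator smul D A \<longleftrightarrow>
     module.subspace smul D \<and>
     (\<forall>x\<in>D. \<forall>y\<in>D. A (x + y) = A x + A y) \<and>
     (\<forall>c. \<forall>x\<in>D. A (smul c x) = smul c (A x)) \<and>
     closed {(x, A x) | x. x \<in> D}"

text \<open>
  Vector-valued integrals are Henstock--Kurzweil integrals, because the Bochner integral of the
  library is restricted to second-countable spaces. On an interval the two agree
  whenever the Bochner integral exists, which is the case for every integrand below: a continuous
  function, or the product of a Lebesgue integrable scalar function and a continuous function.
\<close>

definition local_convoluted_semigroup ::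
    "('s::{real_normed_field, euclidean_space} \<Rightarrow> 'a::banach \<Rightarrow> 'a) \<Rightarrow> real set \<Rightarrow> (real \<Rightarrow> 's) \<Rightarrow>
     'a set \<Rightarrow> ('a \<Rightarrow> 'a) \<Rightarrow> (real \<Rightarrow> 'a \<Rightarrow> 'a) \<Rightarrow> bool" where
  "local_convoluted_semigroup smul I k D A S \<longleftrightarrow>
     time_interval I \<and>
     locally_integrable_on k I \<and>
     closed_linear_operator smul D A \<and>
     (\<forall>t\<in>I. bounded_linear (S t) \<and> (\<forall>c x. S t (smul c x) = smul c (S t x))) \<and>
     (\<forall>x. continuous_on I (\<lambda>t. S t x)) \<and>
     (\<forall>t\<in>I. \<forall>x\<in>D. S t x \<in> D \<and> A (S t x) = S t (A x)) \<and>
     (\<forall>t\<in>I. \<forall>x. integral {0..t} (\<lambda>s. S s x) \<in> D \<and>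
        A (integral {0..t} (\<lambda>s. S s x)) = S t x - smul (integral {0..t} k) x)"

definition nondegenerate :: "real set \<Rightarrow> (real \<Rightarrow> 'a::zero \<Rightarrow> 'a) \<Rightarrow> bool" where
  "nondegenerate I S \<longleftrightarrow> (\<forall>x. (\<forall>t\<in>I. S t x = 0) \<longrightarrow> x = 0)"

text \<open>
  For locally integrable functions the convolution integral converges absolutely for almost every
  \<open>t\<close>; the values on the exceptional null set play no role, as convolutions only occur as integrands.
\<close>

definition convolution ::
    "(real \<Rightarrow> 's::{real_normed_field, euclidean_space}) \<Rightarrow> (real \<Rightarrow> 's) \<Rightarrow> real \<Rightarrow> 's" where
  "convolution f g t = integral {0..t} (\<lambda>s. f (t - s) * g s)"

text \<open>In the next two definitions the index \<open>0\<close> is a dummy; only indices \<open>m \<ge> 1\<close> are meaningful.\<close>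

fun conv_power ::
    "(real \<Rightarrow> 's::{real_normed_field, euclidean_space}) \<Rightarrow> nat \<Rightarrow> real \<Rightarrow> 's" where
  "conv_power k 0 = (\<lambda>t. 0)"
| "conv_power k (Suc 0) = k"
| "conv_power k (Suc (Suc m)) = convolution k (conv_power k (Suc m))"

text \<open>
  \<open>extended_family smul k S \<kappa> m t\<close> is the operator with index \<open>k\<^sup>*\<^sup>m\<close> at time \<open>t \<in> [0, m\<kappa>]\<close>. At
  \<open>t = m\<kappa>\<close> both formulas for the index \<open>m + 1\<close> apply; they agree, see \<open>extended_family_right\<close> below.
\<close>

fun extended_family ::
    "('s::{real_normed_field, euclidean_space} \<Rightarrow> 'a::banach \<Rightarrow> 'a) \<Rightarrow> (real \<Rightarrow> 's) \<Rightarrow>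
     (real \<Rightarrow> 'a \<Rightarrow> 'a) \<Rightarrow> real \<Rightarrow> nat \<Rightarrow> real \<Rightarrow> 'a \<Rightarrow> 'a" where
  "extended_family smul k S \<kappa> 0 = (\<lambda>t x. 0)"
| "extended_family smul k S \<kappa> (Suc 0) = S"
| "extended_family smul k S \<kappa> (Suc (Suc m)) = (\<lambda>t x.
     if t \<le> real (Suc m) * \<kappa> then
       integral {0..t} (\<lambda>s. smul (k (t - s)) (extended_family smul k S \<kappa> (Suc m) s x))
     else
       extended_family smul k S \<kappa> (Suc m) (real (Suc m) * \<kappa>) (S (t - real (Suc m) * \<kappa>) x)
       + integral {0..real (Suc m) * \<kappa>}
           (\<lambda>s. smul (k (t - s)) (extended_family smul k S \<kappa> (Suc m) s x))
       + integral {0..t - real (Suc m) * \<kappa>}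
           (\<lambda>s. smul (conv_power k (Suc m) (t - s)) (S s x)))"

lemma extended_family_left:
  assumes "m \<ge> 1" "t \<le> real m * \<kappa>"
  shows "extended_family smul k S \<kappa> (m + 1) t x =
    integral {0..t} (\<lambda>s. smul (k (t - s)) (extended_family smul k S \<kappa> m s x))"
  using assms by (cases m) auto

lemma local_convoluted_semigroup_0:
  assumes "banach_space_over smul" "local_convoluted_semigroup smul I k D A S"
  shows "S 0 x = 0"
proof -
  interpret banach_space_over smul by fact
  have I: "0 \<in> I"
    using assms(2)
    by (auto simp: local_convoluted_semigroup_def time_interval_def Ico_def zero_ereal_def)
  have cl: "closed_linear_operator smul D A"
    using assms(2) by (simp add: local_convoluted_semigroup_def)
  then have "0 \<in> D"
    by (simp add: closed_linear_operator_def subspace_0)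
  then have "A (0 + 0) = A 0 + A 0"
    using cl unfolding closed_linear_operator_def by blast
  then have "A 0 = 0" by simp
  moreover have "A (integral {0..0} (\<lambda>s. S s x)) = S 0 x - smul (integral {0..0} k) x"
    using assms(2) I unfolding local_convoluted_semigroup_def by blast
  ultimately show ?thesis by simp
qed

lemma extended_family_zero:
  assumes "banach_space_over smul" "local_convoluted_semigroup smul (Ico \<tau>) k D A S"
    and \<kappa>: "0 < \<kappa>" "ereal \<kappa> < \<tau>" and "t \<in> {0..real m * \<kappa>}"
  shows "extended_family smul k S \<kappa> m t 0 = 0"
  using assms(5)
proof (induction m arbitrary: t rule: less_induct)
  case (less m)
  interpret banach_space_over smul by fact
  have S: "S s 0 = 0" if "0 \<le> s" "s \<le> \<kappa>" for s
  proof -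
    have "ereal s < \<tau>" using that(2) \<kappa>(2) by (meson ereal_less_eq(3) le_less_trans)
    then have "s \<in> Ico \<tau>" using that(1) by (simp add: Ico_def)
    then show ?thesis
      using assms(2) by (auto simp: local_convoluted_semigroup_def linear_simps(3))
  qed
  consider "m = 0" | "m = Suc 0" | m' where "m = Suc (Suc m')"
    by (metis nat.exhaust)
  then show ?case
  proof cases
    case 2 then show ?thesis using less.prems S by simp
  next
    case (3 m')
    have ih: "extended_family smul k S \<kappa> (Suc m') s 0 = 0"
      if "0 \<le> s" "s \<le> real (Suc m') * \<kappa>" for s
      using less.IH[of "Suc m'" s] that 3 by simp
    have t: "0 \<le> t" "t - real (Suc m') * \<kappa> \<le> \<kappa>"
      using less.prems 3 by (auto simp: algebra_simps)
    show ?thesis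
    proof (cases "t \<le> real (Suc m') * \<kappa>")
      case True
      have "integral {0..t} (\<lambda>s. smul (k (t - s)) (extended_family smul k S \<kappa> (Suc m') s 0))
          = integral {0..t} (\<lambda>s. 0)"
        using True by (intro integral_cong) (simp add: ih)
      then show ?thesis using True 3 by simp
    next
      case False
      have p: "0 \<le> real (Suc m') * \<kappa>" using \<kappa> by simp
      have "integral {0..real (Suc m') * \<kappa>}
          (\<lambda>s. smul (k (t - s)) (extended_family smul k S \<kappa> (Suc m') s 0))
          = integral {0..real (Suc m') * \<kappa>} (\<lambda>s. 0)"
        by (intro integral_cong) (simp add: ih)
      moreover have "integral {0..t - real (Suc m') * \<kappa>}
          (\<lambda>s. smul (conv_power k (Suc m') (t - s)) (S s 0))
          = integral {0..t - real (Suc m') * \<kappa>} (\<lambda>s. 0)"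
        using t by (intro integral_cong) (simp add: S)
      moreover have "S (t - real (Suc m') * \<kappa>) 0 = 0"
        using t False by (intro S) auto
      ultimately show ?thesis using False 3 ih[OF p] by simp
    qed
  qed simp
qed

lemma extended_family_right:
  assumes "banach_space_over smul" "local_convoluted_semigroup smul (Ico \<tau>) k D A S"
    and "0 < \<kappa>" "ereal \<kappa> < \<tau>" and "m \<ge> 1" "real m * \<kappa> \<le> t"
  shows "extended_family smul k S \<kappa> (m + 1) t x =
      extended_family smul k S \<kappa> m (real m * \<kappa>) (S (t - real m * \<kappa>) x)
      + integral {0..real m * \<kappa>} (\<lambda>s. smul (k (t - s)) (extended_family smul k S \<kappa> m s x))
      + integral {0..t - real m * \<kappa>} (\<lambda>s. smul (conv_power k m (t - s)) (S s x))"
proof (cases "t = real m * \<kappa>")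
  case True
  have "extended_family smul k S \<kappa> m (real m * \<kappa>) (S 0 x) = 0"
    using extended_family_zero[OF assms(1-4)] local_convoluted_semigroup_0[OF assms(1,2)] assms(3)
    by simp
  then show ?thesis using True extended_family_left[of m t \<kappa>] assms(5) by simp
next
  case False
  obtain m' where "m = Suc m'" using assms(5) by (cases m) auto
  then show ?thesis using False assms(6) by simp
qed

end

theory Submission
  imports Defs
begin

text \<open>
  Write \<open>P\<close> for the family with kernel \<open>p\<close> on \<open>[0, a]\<close>, \<open>u = max 0 (t - a)\<close>, \<open>H\<close> and \<open>K\<close> for the
  integrals of \<open>S\<close> and \<open>k\<close> from \<open>0\<close>. Extending \<open>P\<close> by the constant \<open>P a\<close> turns both cases
  of the recursion into one formula, \<open>k * P + P a (S u - K u) + p(a + \<cdot>) * S\<close>, the last convolution being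
  taken at \<open>u\<close>. Since integrating a convolution amounts to integrating either factor, the integral
  over \<open>[0, t]\<close> is \<open>k * G + P a (H u) + p(a + \<cdot>) * H\<close> with \<open>G s\<close> the integral of \<open>P\<close> over
  \<open>[0, min s a]\<close>; now \<open>A\<close> can be applied to each term, and what remains is a scalar identity.

  That different values of \<open>\<kappa>\<close> give the same family does not need uniqueness for the abstract Cauchy
  problem: the integral over \<open>[0, t]\<close> does not depend on the splitting point \<open>a\<close>, because
  \<open>A\<close> can be applied to the derivative of \<open>G b (H (t - b) x)\<close> with respect to \<open>b\<close>.
\<close>

subsection \<open>Convolution of integrable scalar functions\<close>

text \<open>The kernel is only integrable and the values lie in an arbitrary Banach space, so Fubini
  is applied to scalar functions alone. Both sides of a law for integrating a vector convolution are
  additive and sup-norm bounded in the continuous factor, and this factor is a uniform limit of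
  finite sums of scalar functions times fixed vectors; for these the law is scalar.

  \<open>S s x\<close> need not lie in \<open>D\<close>, only its integral does. Hence the integral
  of the new family is rewritten until \<open>A\<close> meets only \<open>G\<close>,
  \<open>H\<close> and the image of \<open>H\<close> under \<open>P a\<close>.

  The term \<open>K u\<close> removes what the constant continuation of \<open>P\<close> adds beyond
  \<open>a\<close>. Every term in \<open>u\<close> vanishes at \<open>u = 0\<close> because
  \<open>S 0 = 0\<close>, so one formula serves on both sides of \<open>a\<close>.

  On the half-open interval one function must serve every \<open>\<kappa>\<close>; its value at
  \<open>t\<close> is taken from \<open>\<kappa> = t / (n + 1)\<close>. This is why families for
  different \<open>\<kappa>\<close> have to be compared.\<close>

lemma lebesgue_measurable_AE_eq_borel:
  fixes f :: "'b::euclidean_space \<Rightarrow> 'c::euclidean_space"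
  assumes "f \<in> borel_measurable lebesgue"
  obtains g where "g \<in> borel_measurable lborel" "AE x in lborel. f x = g x"
proof -
  have "\<exists>h. h \<in> borel_measurable lborel \<and> (AE x in lborel. f x \<bullet> i = h x)" for i
  proof -
    have "(\<lambda>x. f x \<bullet> i) \<in> borel_measurable lebesgue"
      using assms by (intro borel_measurable_inner) auto
    then show ?thesis
      using completion_ex_borel_measurable_real[of "\<lambda>x. f x \<bullet> i" lborel] by blast
  qed
  then obtain h where h: "\<And>i. h i \<in> borel_measurable lborel"
    "\<And>i. AE x in lborel. f x \<bullet> i = h i x"
    by metis
  have "AE x in lborel. \<forall>i\<in>Basis. f x \<bullet> i = h i x"
    using h(2) by (simp add: AE_finite_all)
  then have "AE x in lborel. f x = (\<Sum>i\<in>Basis. h i x *\<^sub>R i)"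
    by eventually_elim (metis (no_types, lifting) euclidean_representation sum.cong)
  moreover have "(\<lambda>x. \<Sum>i\<in>Basis. h i x *\<^sub>R i) \<in> borel_measurable lborel"
    using h(1) by (intro borel_measurable_sum borel_measurable_scaleR) auto
  ultimately show thesis
    using that by blast
qed

text \<open>Fubini for \<open>f (t - s) * g s\<close> needs measurability in the pair
  \<open>(s, t)\<close>, which Borel functions have because subtraction is Borel. Vanishing at
  negative arguments turns integrals over \<open>{0..t}\<close> into integrals over the
  line.\<close>

lemma absolutely_integrable_borel_representative:
  fixes f :: "real \<Rightarrow> 'c::euclidean_space"
  assumes "f absolutely_integrable_on {0..b}"
  obtains f0 N where "integrable lborel f0" "negligible N"
    "\<And>x. x \<in> {0..b} - N \<Longrightarrow> f0 x = f x" "\<And>x. x < 0 \<Longrightarrow> f0 x = 0"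
proof -
  let ?f = "\<lambda>x. indicator {0..b} x *\<^sub>R f x"
  have int: "integrable lebesgue ?f"
    using assms by (simp add: set_integrable_def)
  obtain g where g: "g \<in> borel_measurable lborel" "AE x in lborel. ?f x = g x"
    using lebesgue_measurable_AE_eq_borel[OF borel_measurable_integrable[OF int]] .
  define f0 where "f0 = (\<lambda>x. indicator {0..b} x *\<^sub>R g x)"
  have meas: "f0 \<in> borel_measurable lborel"
    unfolding f0_def using g(1) by measurable
  have ae: "AE x in lborel. ?f x = f0 x"
    using g(2) by eventually_elim (auto simp: f0_def indicator_def split: if_splits)
  then have ae': "AE x in lebesgue. ?f x = f0 x"
    by (rule AE_completion)
  then have "integrable lebesgue f0"
    using int meas by (subst integrable_cong_AE[of f0 _ ?f]) (auto intro: measurable_completion)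
  then have "integrable lborel f0"
    using meas by (simp add: integrable_completion)
  moreover have "negligible {x. ?f x \<noteq> f0 x}"
    using ae' unfolding negligible_iff_null_sets eventually_ae_filter
    by (auto intro: null_sets_completion_subset)
  ultimately show thesis
    by (intro that[of f0 "{x. ?f x \<noteq> f0 x}"]) (auto simp: f0_def)
qed

lemma integral_Icc_eq_lborel:
  fixes f :: "real \<Rightarrow> 'c::euclidean_space"
  assumes "integrable lborel f" "\<And>x. x \<notin> {a..b} \<Longrightarrow> f x = 0"
  shows "integral {a..b} f = integral\<^sup>L lborel f"
proof -
  have "(f has_integral integral\<^sup>L lborel f) UNIV"
    using assms(1) by (rule has_integral_integral_lborel)
  moreover have "(\<lambda>x. if x \<in> {a..b} then f x else 0) = f"
    using assms(2) by auto
  ultimately have "(f has_integral integral\<^sup>L lborel f) {a..b}"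
    using has_integral_restrict_UNIV[of "{a..b}" f] by metis
  then show ?thesis by (rule integral_unique)
qed

text \<open>Fubini on the plane: integrating \<open>f (t - s) * g s\<close> over \<open>s\<close>
  first gives the convolution for almost every \<open>t\<close>; cutting \<open>t\<close> to
  \<open>{0..b}\<close> and integrating over \<open>t\<close> first gives the primitive of
  \<open>f\<close> at \<open>b - s\<close>.\<close>

lemma lborel_convolution:
  fixes f g :: "real \<Rightarrow> 's::{real_normed_field, euclidean_space}"
  assumes f: "integrable lborel f" "\<And>x. x < 0 \<Longrightarrow> f x = 0"
    and g: "integrable lborel g" "\<And>x. x < 0 \<Longrightarrow> g x = 0"
  shows "convolution f g absolutely_integrable_on {0..b}"
    and "integral {0..b} (convolution f g) = integral {0..b} (\<lambda>s. integral {0..b - s} f * g s)"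
proof -
  have [measurable]: "f \<in> borel_measurable borel" "g \<in> borel_measurable borel"
    using f(1) g(1) by auto
  have shift: "integrable lborel (\<lambda>t. f (t - s))" for s
    using lborel_integrable_real_affine[OF f(1), of 1 "-s"] by simp
  have shift': "integral\<^sup>L lborel (\<lambda>t. norm (f (t - s))) = integral\<^sup>L lborel (\<lambda>t. norm (f t))" for s
    using lborel_integral_real_affine[of 1 "\<lambda>t. norm (f t)" "-s"] by simp
  let ?h = "\<lambda>s t. f (t - s) * g s"
  have h: "integrable (lborel \<Otimes>\<^sub>M lborel) (\<lambda>(s, t). ?h s t)"
  proof (rule lborel_pair.Fubini_integrable)
    show "integrable lborel (\<lambda>s. LINT t|lborel. norm (case (s, t) of (s, t) \<Rightarrow> ?h s t))"
      using g(1) by (simp add: norm_mult shift' integrable_norm)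
    show "AE s in lborel. integrable lborel (\<lambda>t. case (s, t) of (s, t) \<Rightarrow> ?h s t)"
      using shift by simp
  qed measurable
  have eq: "convolution f g t = integral\<^sup>L lborel (\<lambda>s. ?h s t)"
    if "integrable lborel (\<lambda>s. ?h s t)" for t
    unfolding convolution_def using that f(2) g(2)
    by (intro integral_Icc_eq_lborel) auto
  obtain N where N: "negligible N" "\<And>t. t \<notin> N \<Longrightarrow> integrable lborel (\<lambda>s. ?h s t)"
  proof -
    have "AE t in lebesgue. integrable lborel (\<lambda>s. ?h s t)"
      using lborel_pair.AE_integrable_snd[OF h] by (rule AE_completion)
    then obtain N where "N \<in> null_sets lebesgue" "{t. \<not> integrable lborel (\<lambda>s. ?h s t)} \<subseteq> N"
      by (auto simp: eventually_ae_filter)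
    then show thesis using that[of N] by (auto simp: negligible_iff_null_sets)
  qed
  have i1: "integrable lborel (\<lambda>t. integral\<^sup>L lborel (\<lambda>s. ?h s t))"
    by (rule lborel_pair.integrable_snd[OF h])
  have "(\<lambda>t. integral\<^sup>L lborel (\<lambda>s. ?h s t)) absolutely_integrable_on {0..b}"
  proof -
    have "set_integrable lborel {0..b} (\<lambda>t. integral\<^sup>L lborel (\<lambda>s. ?h s t))"
      using i1 unfolding set_integrable_def by (intro integrable_mult_indicator) auto
    then show ?thesis
      unfolding set_integrable_def by (subst integrable_completion) auto
  qed
  then show "convolution f g absolutely_integrable_on {0..b}"
    by (rule absolutely_integrable_spike[OF _ N(1)]) (use N eq in auto)
  let ?k = "\<lambda>s t. indicator {0..b} t *\<^sub>R ?h s t"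
  have k: "integrable (lborel \<Otimes>\<^sub>M lborel) (\<lambda>(s, t). ?k s t)"
  proof (rule Bochner_Integration.integrable_bound[OF h])
    show "(\<lambda>(s, t). ?k s t) \<in> borel_measurable (lborel \<Otimes>\<^sub>M lborel)" by measurable
  qed (auto simp: indicator_def)
  have inner: "integral\<^sup>L lborel (\<lambda>t. ?k s t)
      = (if s \<in> {0..b} then integral {0..b - s} f * g s else 0)" for s
  proof (cases "s \<in> {0..b}")
    case True
    have "integral\<^sup>L lborel (\<lambda>t. indicator {0..b} t *\<^sub>R f (t - s))
       = integral\<^sup>L lborel (\<lambda>t. indicator {0..b} (t + s) *\<^sub>R f t)"
      using lborel_integral_real_affine[of 1 "\<lambda>t. indicator {0..b} t *\<^sub>R f (t - s)" s]
      by (simp add: add.commute)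
    also have "\<dots> = integral\<^sup>L lborel (\<lambda>t. indicator {0..b - s} t *\<^sub>R f t)"
      using f(2) True by (intro Bochner_Integration.integral_cong) (auto simp: indicator_def)
    also have "\<dots> = integral {0..b - s} (\<lambda>t. indicator {0..b - s} t *\<^sub>R f t)"
      using f(1) by (intro integral_Icc_eq_lborel[symmetric] integrable_mult_indicator) auto
    also have "\<dots> = integral {0..b - s} f"
      by (intro integral_cong) auto
    finally show ?thesis
      using True by (simp flip: scaleR_scaleR mult_scaleR_left)
  next
    case False
    \<comment> \<open>For \<open>s < 0\<close> the factor \<open>g s\<close> vanishes; for
      \<open>s > b\<close> and \<open>t \<le> b\<close> the argument \<open>t - s\<close> is
      negative.\<close>
    then have "?k s t = 0" for t
      using f(2)[of "t - s"] g(2)[of s] by (auto simp: indicator_def not_le)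
    then have "(\<lambda>t. ?k s t) = (\<lambda>t. 0)"
      by (intro ext)
    then have "integral\<^sup>L lborel (\<lambda>t. ?k s t) = 0" by (simp only: integral_zero)
    then show ?thesis using False by auto
  qed
  have "integral {0..b} (convolution f g) = integral {0..b} (\<lambda>t. integral\<^sup>L lborel (\<lambda>s. ?h s t))"
    by (rule integral_spike[OF N(1)]) (use N eq in auto)
  also have "\<dots> = integral {0..b} (\<lambda>t. integral\<^sup>L lborel (\<lambda>s. ?k s t))"
    by (intro integral_cong) auto
  also have "\<dots> = integral\<^sup>L lborel (\<lambda>t. integral\<^sup>L lborel (\<lambda>s. ?k s t))"
    by (rule integral_Icc_eq_lborel[OF lborel_pair.integrable_snd[OF k]]) auto
  also have "\<dots> = integral\<^sup>L lborel (\<lambda>s. integral\<^sup>L lborel (\<lambda>t. ?k s t))"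
    by (rule lborel_pair.Fubini_integral[OF k])
  also have "\<dots> = integral {0..b} (\<lambda>s. integral\<^sup>L lborel (\<lambda>t. ?k s t))"
    by (rule integral_Icc_eq_lborel[symmetric, OF lborel_pair.integrable_fst[OF k]]) (auto simp: inner)
  also have "\<dots> = integral {0..b} (\<lambda>s. integral {0..b - s} f * g s)"
    by (intro integral_cong) (simp add: inner)
  finally show "integral {0..b} (convolution f g) = integral {0..b} (\<lambda>s. integral {0..b - s} f * g s)" .
qed

lemma negligible_reflect_shift:
  fixes N :: "real set"
  assumes "negligible N"
  shows "negligible {s. t - s \<in> N}"
proof -
  have "{s. t - s \<in> N} = (\<lambda>x. t - x) ` N"
    by (auto simp: image_iff) (metis diff_diff_eq2 add_diff_cancel_left')
  moreover have "negligible ((\<lambda>x. t - x) ` N)"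
    by (rule negligible_differentiable_image_negligible[OF _ assms])
       (auto intro!: derivative_intros simp: differentiable_on_def)
  ultimately show ?thesis by simp
qed

text \<open>For fixed \<open>t\<close> the integrands differ at most on \<open>N\<close> and its
  reflection, so the convolutions agree at every \<open>t \<le> b\<close>, not merely almost
  everywhere.\<close>

lemma convolution_cong_negligible:
  assumes "negligible N" "\<And>x. x \<in> {0..b} - N \<Longrightarrow> f x = f' x \<and> g x = g' x" "t \<le> b"
  shows "convolution f g t = convolution f' g' t"
  unfolding convolution_def
proof (rule integral_spike[of "N \<union> {s. t - s \<in> N}"])
  show "negligible (N \<union> {s. t - s \<in> N})"
    using assms(1) by (simp add: negligible_reflect_shift)
qed (use assms in auto)

lemma has_integral_reflect_Icc:
  fixes f :: "real \<Rightarrow> 'b::real_normed_vector"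
  shows "((\<lambda>s. f (t - s)) has_integral y) {a..b} \<longleftrightarrow> (f has_integral y) {t - b..t - a}"
proof -
  have "((\<lambda>s. f (t - s)) has_integral y) {a..b} \<longleftrightarrow> ((\<lambda>s. f (t + s)) has_integral y) {-b..-a}"
    using has_integral_reflect_real[of "\<lambda>s. f (t - s)" y b a] by simp
  also have "\<dots> \<longleftrightarrow> (f has_integral y) {t - b..t - a}"
    using has_integral_shift_Icc_real[of f t y "-b" "-a"] by (simp add: o_def)
  finally show ?thesis .
qed

lemma integral_reflect_Icc:
  fixes f :: "real \<Rightarrow> 'b::real_normed_vector"
  shows "integral {a..b} (\<lambda>s. f (t - s)) = integral {t - b..t - a} f"
  unfolding integral_def integrable_on_def has_integral_reflect_Icc ..

lemma integrable_reflect_Icc: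
  fixes f :: "real \<Rightarrow> 'b::real_normed_vector"
  shows "(\<lambda>s. f (t - s)) integrable_on {a..b} \<longleftrightarrow> f integrable_on {t - b..t - a}"
  unfolding integrable_on_def has_integral_reflect_Icc ..

text \<open>Holds also where the integral does not exist: reflection preserves existence, so both
  sides then have the same default value.\<close>

lemma convolution_commute: "convolution f g t = convolution g f t"
  unfolding convolution_def
  using integral_reflect_Icc[of 0 t "\<lambda>s. g (t - s) * f s" t] by (simp add: mult.commute)

lemma absolutely_integrable_convolution:
  fixes f g :: "real \<Rightarrow> 's::{real_normed_field, euclidean_space}"
  assumes "f absolutely_integrable_on {0..b}" "g absolutely_integrable_on {0..b}"
  shows "convolution f g absolutely_integrable_on {0..b}"
    and "t \<in> {0..b} \<Longrightarrow> integral {0..t} (convolution f g) = convolution (\<lambda>s. integral {0..s} f) g t"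
proof -
  obtain f0 M where f0: "integrable lborel f0" "negligible M"
    "\<And>x. x \<in> {0..b} - M \<Longrightarrow> f0 x = f x" "\<And>x. x < 0 \<Longrightarrow> f0 x = 0"
    using absolutely_integrable_borel_representative[OF assms(1)] by blast
  obtain g0 N where g0: "integrable lborel g0" "negligible N"
    "\<And>x. x \<in> {0..b} - N \<Longrightarrow> g0 x = g x" "\<And>x. x < 0 \<Longrightarrow> g0 x = 0"
    using absolutely_integrable_borel_representative[OF assms(2)] by blast
  have eq: "convolution f0 g0 t = convolution f g t" if "t \<le> b" for t
    by (rule convolution_cong_negligible[of "M \<union> N" b]) (use f0 g0 that in auto)
  have "convolution f0 g0 absolutely_integrable_on {0..b}"
    by (rule lborel_convolution(1)[OF f0(1,4) g0(1,4)])
  then show "convolution f g absolutely_integrable_on {0..b}"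
    by (rule absolutely_integrable_spike[OF _ negligible_empty]) (use eq in auto)
  assume t: "t \<in> {0..b}"
  have I: "integral {0..s} f0 = integral {0..s} f" if "s \<le> b" for s
    by (rule integral_spike[OF f0(2)]) (use f0(3) that in auto)
  have "integral {0..t} (convolution f g) = integral {0..t} (convolution f0 g0)"
    using t eq by (intro integral_cong) auto
  also have "\<dots> = convolution (\<lambda>s. integral {0..s} f0) g0 t"
    using lborel_convolution(2)[OF f0(1,4) g0(1,4)] by (simp add: convolution_def)
  also have "\<dots> = convolution (\<lambda>s. integral {0..s} f) g t"
    by (rule convolution_cong_negligible[of N b]) (use t g0 I in auto)
  finally show "integral {0..t} (convolution f g) = convolution (\<lambda>s. integral {0..s} f) g t" .
qed

lemma integral_convolution_right:
  fixes f g :: "real \<Rightarrow> 's::{real_normed_field, euclidean_space}"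
  assumes "f absolutely_integrable_on {0..b}" "g absolutely_integrable_on {0..b}" "t \<in> {0..b}"
  shows "integral {0..t} (convolution f g) = convolution f (\<lambda>s. integral {0..s} g) t"
proof -
  have "integral {0..t} (convolution f g) = integral {0..t} (convolution g f)"
    by (intro integral_cong convolution_commute)
  then show ?thesis
    using absolutely_integrable_convolution(2)[OF assms(2,1,3)] by (simp add: convolution_commute)
qed

subsection \<open>Integrals of an integrable scalar times a continuous vector function\<close>

text \<open>The error is controlled in mean because the scalar factor of later integrands may be
  unbounded. Along a fine division the Riemann sums of \<open>f\<close> and \<open>g\<close> differ
  by at most a Riemann sum of \<open>h\<close>, which is close to its small integral; so the sums of
  \<open>f\<close> are Cauchy.\<close>

lemma integrable_on_if_L1_approximable:
  fixes f :: "'n::euclidean_space \<Rightarrow> 'b::banach"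
  assumes "\<And>e. 0 < e \<Longrightarrow> \<exists>g h. g integrable_on cbox a b \<and> h integrable_on cbox a b \<and>
    integral (cbox a b) h \<le> e \<and> (\<forall>x\<in>cbox a b. norm (f x - g x) \<le> h x)"
  shows "f integrable_on cbox a b"
  unfolding integrable_Cauchy
proof (intro allI impI)
  fix e :: real assume "0 < e"
  \<comment> \<open>A sum of \<open>f\<close> is within \<open>3 * (e / 6)\<close> of the integral
    of \<open>g\<close>: one part for the sum of \<open>g\<close>, one for the integral of
    \<open>h\<close> and one for the sum of \<open>h\<close>. Two sums of \<open>f\<close> then
    differ by less than \<open>e\<close>.\<close>
  then have e: "0 < e / 6" by simp
  obtain g h where g: "g integrable_on cbox a b" and h: "h integrable_on cbox a b"
    and h_le: "integral (cbox a b) h \<le> e / 6"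
    and fg: "\<And>x. x \<in> cbox a b \<Longrightarrow> norm (f x - g x) \<le> h x"
    using assms[OF e] by blast
  define R where "R p u = (\<Sum>(x, K)\<in>p. measure lborel K *\<^sub>R u x)" for p :: "('n \<times> 'n set) set" and u :: "'n \<Rightarrow> 'b"
  obtain \<gamma>1 where \<gamma>1: "gauge \<gamma>1"
    "\<And>p. p tagged_division_of cbox a b \<Longrightarrow> \<gamma>1 fine p \<Longrightarrow>
      norm (R p g - integral (cbox a b) g) < e / 6"
    using integrable_integral[OF g] e unfolding has_integral R_def by metis
  obtain \<gamma>2 where \<gamma>2: "gauge \<gamma>2"
    "\<And>p. p tagged_division_of cbox a b \<Longrightarrow> \<gamma>2 fine p \<Longrightarrow>
      norm ((\<Sum>(x, K)\<in>p. measure lborel K *\<^sub>R h x) - integral (cbox a b) h) < e / 6"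
    using integrable_integral[OF h] e unfolding has_integral by metis
  have close: "norm (R p f - integral (cbox a b) g) < e / 2"
    if p: "p tagged_division_of cbox a b" "\<gamma>1 fine p" "\<gamma>2 fine p" for p
  proof -
    have "R p f - R p g = (\<Sum>(x, K)\<in>p. measure lborel K *\<^sub>R (f x - g x))"
      unfolding R_def by (simp add: sum_subtractf[symmetric] split_def algebra_simps)
    also have "norm \<dots> \<le> (\<Sum>(x, K)\<in>p. measure lborel K *\<^sub>R h x)"
    proof (rule sum_norm_le, clarify)
      fix x K assume "(x, K) \<in> p"
      then have "x \<in> cbox a b" using p(1) by (rule tag_in_interval[rotated])
      then show "norm (measure lborel K *\<^sub>R (f x - g x)) \<le> measure lborel K *\<^sub>R h x"
        using fg by (simp add: mult_left_mono)
    qed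
    finally have "norm (R p f - R p g) \<le> (\<Sum>(x, K)\<in>p. measure lborel K *\<^sub>R h x)" .
    moreover have "(\<Sum>(x, K)\<in>p. measure lborel K *\<^sub>R h x) < e / 6 + e / 6"
      using \<gamma>2(2)[OF p(1,3)] h_le unfolding real_norm_def abs_less_iff by linarith
    moreover have "norm (R p g - integral (cbox a b) g) < e / 6"
      by (rule \<gamma>1(2)[OF p(1,2)])
    ultimately show ?thesis
      using norm_triangle_ineq[of "R p f - R p g" "R p g - integral (cbox a b) g"] by simp
  qed
  show "\<exists>\<gamma>. gauge \<gamma> \<and> (\<forall>p q. p tagged_division_of cbox a b \<and> \<gamma> fine p \<and>
      q tagged_division_of cbox a b \<and> \<gamma> fine q \<longrightarrow>
      norm ((\<Sum>(x, K)\<in>p. measure lborel K *\<^sub>R f x) - (\<Sum>(x, K)\<in>q. measure lborel K *\<^sub>R f x)) < e)"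
  proof (intro exI[of _ "\<lambda>x. \<gamma>1 x \<inter> \<gamma>2 x"] conjI allI impI)
    show "gauge (\<lambda>x. \<gamma>1 x \<inter> \<gamma>2 x)" by (rule gauge_Int[OF \<gamma>1(1) \<gamma>2(1)])
    fix p q
    assume "p tagged_division_of cbox a b \<and> (\<lambda>x. \<gamma>1 x \<inter> \<gamma>2 x) fine p \<and>
      q tagged_division_of cbox a b \<and> (\<lambda>x. \<gamma>1 x \<inter> \<gamma>2 x) fine q"
    then have "norm (R p f - integral (cbox a b) g) < e / 2"
      "norm (R q f - integral (cbox a b) g) < e / 2"
      using close by (auto simp: fine_Int)
    then have "norm (R p f - R q f) < e"
      using norm_triangle_ineq4[of "R p f - integral (cbox a b) g" "R q f - integral (cbox a b) g"]
      by simp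
    then show "norm ((\<Sum>(x, K)\<in>p. measure lborel K *\<^sub>R f x) - (\<Sum>(x, K)\<in>q. measure lborel K *\<^sub>R f x)) < e"
      by (simp add: R_def)
  qed
qed

text \<open>Take a partition of unity subordinate to finitely many balls on which \<open>F\<close>
  stays within \<open>e\<close> of its value at the centre. The weighted values at the centres form
  a convex combination of points close to \<open>F s\<close>.\<close>

lemma continuous_on_compact_approx_separable:
  fixes F :: "'m::metric_space \<Rightarrow> 'b::real_normed_vector"
  assumes "compact S" "continuous_on S F" "0 < e"
  obtains I :: "'m set set" and \<phi> v where "finite I" "\<And>i. i \<in> I \<Longrightarrow> continuous_on S (\<phi> i :: 'm \<Rightarrow> real)"
    "\<And>s. s \<in> S \<Longrightarrow> norm (F s - (\<Sum>i\<in>I. \<phi> i s *\<^sub>R v i)) \<le> e"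
proof -
  have "\<exists>d>0. \<forall>y\<in>S. dist y x < d \<longrightarrow> dist (F y) (F x) < e" if "x \<in> S" for x
    using assms(2,3) that by (simp add: continuous_on_iff)
  then obtain d where d: "\<And>x. x \<in> S \<Longrightarrow> 0 < d x"
    "\<And>x y. x \<in> S \<Longrightarrow> y \<in> S \<Longrightarrow> dist y x < d x \<Longrightarrow> dist (F y) (F x) < e"
    by metis
  obtain X where X: "X \<subseteq> S" "finite X" "S \<subseteq> (\<Union>c\<in>X. ball c (d c))"
  proof (rule compactE_image[OF assms(1), of S "\<lambda>c. ball c (d c)"])
    show "S \<subseteq> (\<Union>c\<in>S. ball c (d c))" using d(1) by force
  qed auto
  \<comment> \<open>The partition of unity is indexed by the balls as sets; \<open>c\<close>
    recovers a centre from each of them.\<close>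
  define I where "I = (\<lambda>c. ball c (d c)) ` X"
  have finI: "finite I" using X(2) by (simp add: I_def)
  obtain c where c: "\<And>U. U \<in> I \<Longrightarrow> c U \<in> X \<and> U = ball (c U) (d (c U))"
    unfolding I_def by (metis image_iff)
  obtain \<phi> :: "'m set \<Rightarrow> 'm \<Rightarrow> real"
    where \<phi>: "\<And>U. U \<in> I \<Longrightarrow> continuous_on S (\<phi> U) \<and> (\<forall>x\<in>S. 0 \<le> \<phi> U x)"
      "\<And>x U. U \<in> I \<Longrightarrow> x \<in> S \<Longrightarrow> x \<notin> U \<Longrightarrow> \<phi> U x = 0"
      "\<And>x. x \<in> S \<Longrightarrow> supp_sum (\<lambda>W. \<phi> W x) I = 1"
  proof (rule subordinate_partition_of_unity[of S I])
    show "S \<subseteq> \<Union> I" using X(3) by (simp add: I_def)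
    show "\<And>T. T \<in> I \<Longrightarrow> open T" by (auto simp: I_def)
    show "\<And>x. x \<in> S \<Longrightarrow> \<exists>V. open V \<and> x \<in> V \<and> finite {U \<in> I. U \<inter> V \<noteq> {}}"
      using finI by (intro exI[of _ UNIV]) auto
  qed blast
  have one: "(\<Sum>U\<in>I. \<phi> U s) = 1" if "s \<in> S" for s
  proof -
    have "(\<Sum>U\<in>I. \<phi> U s) = supp_sum (\<lambda>W. \<phi> W s) I"
      unfolding supp_sum_def support_on_def
      by (rule sum.mono_neutral_right[OF finI]) auto
    then show ?thesis using \<phi>(3)[OF that] by simp
  qed
  show thesis
  proof (rule that[of I \<phi> "\<lambda>U. F (c U)"])
    show "norm (F s - (\<Sum>U\<in>I. \<phi> U s *\<^sub>R F (c U))) \<le> e" if s: "s \<in> S" for s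
    proof -
      have "F s - (\<Sum>U\<in>I. \<phi> U s *\<^sub>R F (c U)) = (\<Sum>U\<in>I. \<phi> U s *\<^sub>R (F s - F (c U)))"
        using one[OF s] by (simp add: scaleR_diff_right sum_subtractf flip: scaleR_left.sum)
      also have "norm \<dots> \<le> (\<Sum>U\<in>I. \<phi> U s * e)"
      proof (rule sum_norm_le)
        fix U assume U: "U \<in> I"
        show "norm (\<phi> U s *\<^sub>R (F s - F (c U))) \<le> \<phi> U s * e"
        proof (cases "s \<in> U")
          case True
          then have "dist s (c U) < d (c U)" using c[OF U] by (metis mem_ball dist_commute)
          then have "dist (F s) (F (c U)) < e" using d(2) c[OF U] X(1) s by blast
          then show ?thesis using \<phi>(1)[OF U] s by (simp add: dist_norm mult_left_mono)
        next
          case False then show ?thesis using \<phi>(2)[OF U s] by simp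
        qed
      qed
      also have "\<dots> = e" using one[OF s] by (simp flip: sum_distrib_right)
      finally show ?thesis .
    qed
  qed (use finI \<phi>(1) in auto)
qed

text \<open>Density argument, meant for \<open>L\<close> the difference of the two sides of an
  identity. Splitting off a separable approximation of \<open>F\<close> leaves a remainder of sup
  norm at most \<open>e\<close>, on which \<open>L\<close> is at most
  \<open>\<bar>C\<bar> * e\<close>.\<close>

lemma bounded_functional_eq_0_if_eq_0_on_separable:
  fixes L :: "(real \<Rightarrow> 'b::real_normed_vector) \<Rightarrow> 'c::real_normed_vector"
  assumes add: "\<And>F G. continuous_on {0..b} F \<Longrightarrow> continuous_on {0..b} G \<Longrightarrow>
      L (\<lambda>s. F s + G s) = L F + L G"
    and bound: "\<And>F M. continuous_on {0..b} F \<Longrightarrow> 0 \<le> M \<Longrightarrow> (\<And>s. s \<in> {0..b} \<Longrightarrow> norm (F s) \<le> M) \<Longrightarrow>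
      norm (L F) \<le> C * M"
    and sep: "\<And>\<phi> v. continuous_on {0..b} \<phi> \<Longrightarrow> L (\<lambda>s. \<phi> s *\<^sub>R v) = 0"
    and F: "continuous_on {0..b} F"
  shows "L F = 0"
proof -
  have "norm (L F) \<le> \<bar>C\<bar> * e" if "0 < e" for e
  proof -
    obtain I :: "real set set" and \<phi> v where I: "finite I" "\<And>i. i \<in> I \<Longrightarrow> continuous_on {0..b} (\<phi> i)"
      "\<And>s. s \<in> {0..b} \<Longrightarrow> norm (F s - (\<Sum>i\<in>I. \<phi> i s *\<^sub>R v i)) \<le> e"
      using continuous_on_compact_approx_separable[OF compact_Icc F \<open>0 < e\<close>] by blast
    let ?G = "\<lambda>J s. \<Sum>i\<in>J. \<phi> i s *\<^sub>R v i"
    have cont: "continuous_on {0..b} (?G J)" if "J \<subseteq> I" for J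
      using that by (intro continuous_intros I(2)) auto
    have "L (?G J) = 0" if "finite J" "J \<subseteq> I" for J
      using that
    proof (induction J)
      case empty
      show ?case using sep[of "\<lambda>s. 0" 0] by simp
    next
      case (insert i J)
      have "L (\<lambda>s. \<phi> i s *\<^sub>R v i + ?G J s) = L (\<lambda>s. \<phi> i s *\<^sub>R v i) + L (?G J)"
        using insert.prems by (intro add continuous_intros I(2)) auto
      then show ?case using insert sep I(2) by simp
    qed
    then have "L (?G I) = 0" using I(1) by simp
    moreover have "L (\<lambda>s. (F s - ?G I s) + ?G I s) = L (\<lambda>s. F s - ?G I s) + L (?G I)"
      using F cont[of I] by (intro add continuous_on_diff) auto
    ultimately have "L F = L (\<lambda>s. F s - ?G I s)" by simp
    also have "norm \<dots> \<le> C * e"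
      using F cont[of I] I(3) \<open>0 < e\<close> by (intro bound continuous_on_diff) auto
    also have "\<dots> \<le> \<bar>C\<bar> * e" using \<open>0 < e\<close> by (intro mult_right_mono) auto
    finally show ?thesis .
  qed
  note le = this
  have "norm (L F) \<le> 0"
  proof (rule field_le_epsilon)
    fix e :: real assume "0 < e"
    then have "norm (L F) \<le> \<bar>C\<bar> * (e / (\<bar>C\<bar> + 1))" by (intro le) auto
    also have "\<dots> \<le> e" using \<open>0 < e\<close> by (simp add: field_simps)
    finally show "norm (L F) \<le> 0 + e" by simp
  qed
  then show ?thesis by simp
qed

lemma absolutely_integrable_on_reflect_Icc:
  fixes f :: "real \<Rightarrow> 'b::euclidean_space"
  assumes "f absolutely_integrable_on {t - b..t - a}"
  shows "(\<lambda>s. f (t - s)) absolutely_integrable_on {a..b}"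
  using assms integrable_reflect_Icc[of f t a b] integrable_reflect_Icc[of "\<lambda>x. norm (f x)" t a b]
  by (simp add: absolutely_integrable_on_def)

lemma absolutely_integrable_on_shift_Icc:
  fixes f :: "real \<Rightarrow> 'b::euclidean_space"
  assumes "f absolutely_integrable_on {c + a..c + b}"
  shows "(\<lambda>s. f (c + s)) absolutely_integrable_on {a..b}"
  using assms integrable_on_shift_Icc_real[of f c a b]
    integrable_on_shift_Icc_real[of "\<lambda>x. norm (f x)" c a b]
  by (simp add: absolutely_integrable_on_def o_def add.commute)

text \<open>Continuity, differences and the bounded partial maps of \<open>smul\<close> for scalars
  in \<open>'s\<close> all come from this bilinearity.\<close>

sublocale banach_space_over \<subseteq> smul: bounded_bilinear smul
proof
  have scaleR: "smul (r *\<^sub>R c) x = r *\<^sub>R smul c x" for r c x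
    by (simp add: smul_of_real scaleR_conv_of_real flip: scale_scale)
  show "smul (r *\<^sub>R c) x = r *\<^sub>R smul c x" for r c x by (rule scaleR)
  show "smul c (r *\<^sub>R x) = r *\<^sub>R smul c x" for r c x
    by (metis scale_left_commute smul_of_real)
  show "\<exists>K. \<forall>a b. norm (smul a b) \<le> norm a * norm b * K"
    by (intro exI[of _ 1]) (simp add: norm_smul)
qed (simp_all add: scale_left_distrib scale_right_distrib)

context banach_space_over
begin

text \<open>The product with \<open>f\<close> is integrable for step functions, and \<open>F\<close>
  is uniformly close to step functions. The error is then at most a constant times
  \<open>norm (f s)\<close>, which is small in mean even if \<open>f\<close> is unbounded.\<close>

lemma integrable_smul:
  assumes f: "f absolutely_integrable_on {a..b}" and F: "continuous_on {a..b} F"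
  shows "(\<lambda>s. smul (f s) (F s)) integrable_on {a..b::real}"
proof (cases "a \<le> b")
  case True
  have fi: "f integrable_on {a..b}" and nfi: "(\<lambda>s. norm (f s)) integrable_on {a..b}"
    using f by (auto simp: absolutely_integrable_on_def)
  define B where "B = integral {a..b} (\<lambda>s. norm (f s))"
  have B: "0 \<le> B" unfolding B_def by (rule integral_nonneg[OF nfi]) simp
  have step: "\<exists>g. (\<lambda>s. smul (f s) (g s)) integrable_on {a..b} \<and> (\<forall>s\<in>{a..b}. norm (F s - g s) \<le> \<delta>)"
    if "0 < \<delta>" for \<delta>
  proof -
    define Q where "Q c d \<longleftrightarrow>
      (\<exists>g. (\<lambda>s. smul (f s) (g s)) integrable_on {c..d} \<and> (\<forall>s\<in>{c..d}. norm (F s - g s) \<le> \<delta>))" for c d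
    \<comment> \<open>Bisection: the approximation property passes to unions of adjacent intervals
      and holds on short ones, where \<open>F\<close> is replaced by a single value.\<close>
    have "a \<le> a \<and> a \<le> b \<and> b \<le> b \<longrightarrow> Q a b"
      using True
    proof (rule Bolzano[where P = "\<lambda>c d. a \<le> c \<and> c \<le> d \<and> d \<le> b \<longrightarrow> Q c d"])
      fix c m d
      assume trans: "a \<le> c \<and> c \<le> m \<and> m \<le> b \<longrightarrow> Q c m"
        "a \<le> m \<and> m \<le> d \<and> d \<le> b \<longrightarrow> Q m d" "c \<le> m" "m \<le> d"
      show "a \<le> c \<and> c \<le> d \<and> d \<le> b \<longrightarrow> Q c d"
      proof
        assume cd: "a \<le> c \<and> c \<le> d \<and> d \<le> b"
        obtain g1 where g1: "(\<lambda>s. smul (f s) (g1 s)) integrable_on {c..m}"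
          "\<forall>s\<in>{c..m}. norm (F s - g1 s) \<le> \<delta>"
          using trans cd by (auto simp: Q_def)
        obtain g2 where g2: "(\<lambda>s. smul (f s) (g2 s)) integrable_on {m..d}"
          "\<forall>s\<in>{m..d}. norm (F s - g2 s) \<le> \<delta>"
          using trans cd by (auto simp: Q_def)
        define g where "g s = (if s \<le> m then g1 s else g2 s)" for s
        have "(\<lambda>s. smul (f s) (g s)) integrable_on {c..m}"
          by (rule integrable_eq[OF g1(1)]) (simp add: g_def)
        \<comment> \<open>At \<open>m\<close> the glued function takes the value of
          \<open>g1\<close>, whence one exceptional point.\<close>
        moreover have "(\<lambda>s. smul (f s) (g s)) integrable_on {m..d}"
          by (rule integrable_spike_finite[OF _ _ g2(1), of "{m}"]) (auto simp: g_def)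
        ultimately have "(\<lambda>s. smul (f s) (g s)) integrable_on {c..d}"
          by (rule Henstock_Kurzweil_Integration.integrable_combine[OF trans(3,4)])
        then show "Q c d"
          using g1(2) g2(2) unfolding Q_def by (intro exI[of _ g]) (auto simp: g_def)
      qed
    next
      fix x assume local: "a \<le> x" "x \<le> b"
      obtain d where d: "0 < d" "\<And>y. y \<in> {a..b} \<Longrightarrow> dist y x < d \<Longrightarrow> dist (F y) (F x) < \<delta>"
        using F local \<open>0 < \<delta>\<close> unfolding continuous_on_iff by (metis atLeastAtMost_iff)
      show "\<exists>d>0. \<forall>c e. c \<le> x \<and> x \<le> e \<and> e - c < d \<longrightarrow> a \<le> c \<and> c \<le> e \<and> e \<le> b \<longrightarrow> Q c e"
      proof (intro exI[of _ d] conjI allI impI)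
        fix c e assume c: "c \<le> x \<and> x \<le> e \<and> e - c < d" "a \<le> c \<and> c \<le> e \<and> e \<le> b"
        then have "f integrable_on {c..e}"
          using integrable_subinterval_real[OF fi] by auto
        then have "(\<lambda>s. smul (f s) (F x)) integrable_on {c..e}"
          using integrable_linear[OF _ smul.bounded_linear_left[of "F x"]] by (simp add: o_def)
        moreover have "norm (F s - F x) \<le> \<delta>" if "s \<in> {c..e}" for s
          using d(2)[of s] that c by (auto simp: dist_norm abs_if less_imp_le)
        ultimately show "Q c e"
          unfolding Q_def by (intro exI[of _ "\<lambda>s. F x"]) auto
      qed (use d in auto)
    qed
    then show ?thesis using True by (auto simp: Q_def)
  qed
  have "(\<lambda>s. smul (f s) (F s)) integrable_on cbox a b"
  proof (rule integrable_on_if_L1_approximable)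
    fix e :: real assume e: "0 < e"
    \<comment> \<open>The uniform error is multiplied by the integral \<open>B\<close> of
      \<open>norm (f s)\<close>; adding 1 covers \<open>B = 0\<close>.\<close>
    then have "0 < e / (B + 1)" using B by simp
    then obtain g where g: "(\<lambda>s. smul (f s) (g s)) integrable_on {a..b}"
      "\<And>s. s \<in> {a..b} \<Longrightarrow> norm (F s - g s) \<le> e / (B + 1)"
      using step by blast
    have "integral {a..b} (\<lambda>s. e / (B + 1) * norm (f s)) = e / (B + 1) * B"
      by (simp add: B_def)
    also have "\<dots> \<le> e" using e B by (simp add: field_simps)
    finally have le: "integral {a..b} (\<lambda>s. e / (B + 1) * norm (f s)) \<le> e" .
    have "norm (smul (f s) (F s) - smul (f s) (g s)) \<le> e / (B + 1) * norm (f s)"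
      if "s \<in> {a..b}" for s
    proof -
      have "norm (smul (f s) (F s) - smul (f s) (g s)) = norm (f s) * norm (F s - g s)"
        by (simp flip: norm_smul smul.diff_right)
      also have "\<dots> \<le> norm (f s) * (e / (B + 1))"
        by (intro mult_left_mono g(2) that) simp
      finally show ?thesis by (simp add: mult.commute)
    qed
    then show "\<exists>g h. g integrable_on cbox a b \<and> h integrable_on cbox a b \<and>
      integral (cbox a b) h \<le> e \<and> (\<forall>s\<in>cbox a b. norm (smul (f s) (F s) - g s) \<le> h s)"
      using g(1) le integrable_on_mult_right[OF nfi, of "e / (B + 1)"]
      by (intro exI[of _ "\<lambda>s. smul (f s) (g s)"] exI[of _ "\<lambda>s. e / (B + 1) * norm (f s)"]) auto
  qed
  then show ?thesis by simp
next
  case False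
  then show ?thesis by (simp add: integrable_on_empty)
qed

lemma norm_integral_smul_le:
  assumes f: "f absolutely_integrable_on {a..b::real}" and F: "continuous_on {a..b} F"
    and M: "\<And>s. s \<in> {a..b} \<Longrightarrow> norm (F s) \<le> M"
  shows "norm (integral {a..b} (\<lambda>s. smul (f s) (F s))) \<le> integral {a..b} (\<lambda>s. norm (f s)) * M"
proof -
  have nfi: "(\<lambda>s. norm (f s)) integrable_on {a..b}"
    using f by (auto simp: absolutely_integrable_on_def)
  have "norm (integral {a..b} (\<lambda>s. smul (f s) (F s))) \<le> integral {a..b} (\<lambda>s. norm (f s) * M)"
  proof (rule Henstock_Kurzweil_Integration.integral_norm_bound_integral)
    show "(\<lambda>s. norm (f s) * M) integrable_on {a..b}"
      using nfi by (rule integrable_on_mult_left)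
  qed (use M in \<open>auto simp: norm_smul integrable_smul[OF f F] intro: mult_left_mono\<close>)
  then show ?thesis by simp
qed

end

text \<open>The scalar field as a Banach space over itself: the vector lemmas then also cover scalar
  convolutions with a continuous factor.\<close>

lemma banach_space_over_times:
  "banach_space_over ((*) :: 's::{real_normed_field, euclidean_space} \<Rightarrow> 's \<Rightarrow> 's)"
  by unfold_locales (simp_all add: algebra_simps norm_mult scaleR_conv_of_real)

lemma absolutely_integrable_on_Icc_subset:
  assumes "f absolutely_integrable_on {a..b::real}" "a \<le> c" "d \<le> b"
  shows "f absolutely_integrable_on {c..d}"
  using assms by (auto intro: set_integrable_subset)

section \<open>Convolution of an integrable scalar function with a continuous vector
  function\<close>

context banach_space_over
begin

definition vconv :: "(real \<Rightarrow> 's) \<Rightarrow> (real \<Rightarrow> 'a) \<Rightarrow> real \<Rightarrow> 'a" where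
  "vconv f F t = integral {0..t} (\<lambda>s. smul (f (t - s)) (F s))"

lemma vconv_0 [simp]: "vconv f F 0 = 0"
  by (simp add: vconv_def)

lemma vconv_cong:
  "(\<And>s. 0 \<le> s \<Longrightarrow> s \<le> t \<Longrightarrow> f s = g s) \<Longrightarrow> (\<And>s. 0 \<le> s \<Longrightarrow> s \<le> t \<Longrightarrow> F s = G s) \<Longrightarrow>
    vconv f F t = vconv g G t"
  unfolding vconv_def by (intro integral_cong) auto

lemma integrable_vconv:
  assumes f: "f absolutely_integrable_on {0..b::real}" and F: "continuous_on {0..b} F" and t: "t \<le> b"
  shows "(\<lambda>s. smul (f (t - s)) (F s)) integrable_on {0..t}"
proof (rule integrable_smul)
  show "(\<lambda>s. f (t - s)) absolutely_integrable_on {0..t}"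
    using absolutely_integrable_on_Icc_subset[OF f _ t, of 0]
    by (intro absolutely_integrable_on_reflect_Icc) simp
  show "continuous_on {0..t} F" using F by (rule continuous_on_subset) (use t in auto)
qed

lemma vconv_add:
  assumes f: "f absolutely_integrable_on {0..b}" and "continuous_on {0..b} F" "continuous_on {0..b} G"
    and t: "t \<le> b"
  shows "vconv f (\<lambda>s. F s + G s) t = vconv f F t + vconv f G t"
  unfolding vconv_def smul.add_right using assms by (intro integral_add integrable_vconv)

lemma vconv_smul:
  assumes f: "f absolutely_integrable_on {0..b}" and "continuous_on {0..b} F" and t: "t \<le> b"
  shows "vconv f (\<lambda>s. smul c (F s)) t = smul c (vconv f F t)"
proof -
  have "smul (f (t - s)) (smul c (F s)) = smul c (smul (f (t - s)) (F s))" for s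
    by (rule scale_left_commute)
  then show ?thesis
    unfolding vconv_def
    using integral_linear[OF integrable_vconv[OF assms] smul.bounded_linear_right[of c]]
    by (simp only: o_def)
qed

lemma norm_vconv_le:
  assumes f: "f absolutely_integrable_on {0..b}" and F: "continuous_on {0..b} F" and t: "t \<le> b"
    and M: "0 \<le> M" "\<And>s. s \<in> {0..b} \<Longrightarrow> norm (F s) \<le> M"
  shows "norm (vconv f F t) \<le> integral {0..b} (\<lambda>s. norm (f s)) * M"
proof -
  have nfi: "(\<lambda>s. norm (f s)) integrable_on {0..b}"
    using f by (auto simp: absolutely_integrable_on_def)
  have "norm (vconv f F t) \<le> integral {0..t} (\<lambda>s. norm (f (t - s))) * M"
    unfolding vconv_def
  proof (rule norm_integral_smul_le)
    show "(\<lambda>s. f (t - s)) absolutely_integrable_on {0..t}"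
      using absolutely_integrable_on_Icc_subset[OF f _ t, of 0]
      by (intro absolutely_integrable_on_reflect_Icc) simp
    show "continuous_on {0..t} F" using F by (rule continuous_on_subset) (use t in auto)
  qed (use M t in auto)
  also have "\<dots> = integral {0..t} (\<lambda>s. norm (f s)) * M"
    using integral_reflect_Icc[of 0 t "\<lambda>s. norm (f s)" t] by simp
  also have "\<dots> \<le> integral {0..b} (\<lambda>s. norm (f s)) * M"
    using t integrable_subinterval_real[OF nfi, of 0 t]
    by (intro mult_right_mono M(1) integral_subset_le nfi) auto
  finally show ?thesis .
qed

lemma integral_smul_const:
  "f integrable_on X \<Longrightarrow> integral X (\<lambda>s. smul (f s) v) = smul (integral X f) v"
  using integral_linear[OF _ smul.bounded_linear_left[of v], of f X] by (simp add: o_def)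

lemma vconv_const:
  assumes "f integrable_on {0..t}"
  shows "vconv f (\<lambda>s. v) t = smul (integral {0..t} f) v"
proof -
  have "(\<lambda>s. f (t - s)) integrable_on {0..t}"
    using assms by (simp add: integrable_reflect_Icc)
  then show ?thesis
    unfolding vconv_def using integral_reflect_Icc[of 0 t f t] by (simp add: integral_smul_const)
qed

lemma vconv_separable:
  assumes f: "f absolutely_integrable_on {0..b}" and \<phi>: "continuous_on {0..b} \<phi>" and t: "t \<le> b"
  shows "vconv f (\<lambda>s. smul (\<phi> s) v) t = smul (convolution f \<phi> t) v"
proof -
  interpret scalar: banach_space_over "(*) :: 's \<Rightarrow> 's \<Rightarrow> 's" by (rule banach_space_over_times)
  have "(\<lambda>s. f (t - s) * \<phi> s) integrable_on {0..t}"
    by (rule scalar.integrable_vconv[OF f \<phi> t])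
  then show ?thesis
    by (simp add: vconv_def convolution_def flip: integral_smul_const)
qed

text \<open>Extending \<open>F\<close> to negative times by \<open>F 0\<close> gives an integral over a fixed interval, in which
  \<open>t\<close> occurs in the argument of the uniformly continuous factor only.\<close>

lemma continuous_on_vconv:
  assumes f: "f absolutely_integrable_on {0..b}" and F: "continuous_on {0..b} F"
  shows "continuous_on {0..b} (vconv f F)"
proof -
  define E where "E x = F (max 0 x)" for x
  have E: "continuous_on {-b..b} E"
    unfolding E_def by (rule continuous_on_compose2[OF F]) (auto intro!: continuous_intros)
  have Ei: "continuous_on {0..b} (\<lambda>s. E (t - s))" if "t \<in> {0..b}" for t
    by (rule continuous_on_compose2[OF E]) (use that in \<open>auto intro!: continuous_intros\<close>)
  have int: "(\<lambda>s. smul (f s) (E (t - s))) integrable_on {0..b}" if "t \<in> {0..b}" for t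
    by (rule integrable_smul[OF f Ei[OF that]])
  define B where "B = integral {0..b} (\<lambda>s. norm (f s))"
  have B: "0 \<le> B"
    unfolding B_def using f by (intro integral_nonneg) (auto simp: absolutely_integrable_on_def)
  \<comment> \<open>For \<open>s\<close> in \<open>{t..b}\<close> the argument \<open>t - s\<close>
    is at most 0, so \<open>E\<close> equals \<open>F 0\<close> there; the second integral removes
    this part.\<close>
  have eq: "vconv f F t = integral {0..b} (\<lambda>s. smul (f s) (E (t - s)))
      - integral {t..b} (\<lambda>s. smul (f s) (F 0))" if t: "t \<in> {0..b}" for t
  proof -
    have "vconv f F t = integral {0..t} (\<lambda>s. smul (f s) (F (t - s)))"
      unfolding vconv_def using integral_reflect_Icc[of 0 t "\<lambda>s. smul (f s) (F (t - s))" t] by simp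
    also have "\<dots> = integral {0..t} (\<lambda>s. smul (f s) (E (t - s)))"
      by (intro integral_cong) (simp add: E_def)
    finally have "vconv f F t = integral {0..t} (\<lambda>s. smul (f s) (E (t - s)))" .
    moreover have "integral {t..b} (\<lambda>s. smul (f s) (F 0)) = integral {t..b} (\<lambda>s. smul (f s) (E (t - s)))"
      by (intro integral_cong) (simp add: E_def)
    ultimately show ?thesis
      using Henstock_Kurzweil_Integration.integral_combine[OF _ _ int[OF t], of t] t
      by (simp add: algebra_simps)
  qed
  have "continuous_on {0..b} (\<lambda>t. integral {0..b} (\<lambda>s. smul (f s) (E (t - s))))"
    unfolding continuous_on_iff
  proof (intro ballI allI impI)
    fix t e :: real assume t: "t \<in> {0..b}" and e: "0 < e"
    have "uniformly_continuous_on {-b..b} E"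
      using E by (intro compact_uniformly_continuous) auto
    moreover have "0 < e / (B + 1)" using e B by simp
    ultimately obtain d where d: "0 < d"
      "\<And>x y. x \<in> {-b..b} \<Longrightarrow> y \<in> {-b..b} \<Longrightarrow> dist y x < d \<Longrightarrow> dist (E y) (E x) < e / (B + 1)"
      unfolding uniformly_continuous_on_def by metis
    show "\<exists>d>0. \<forall>u\<in>{0..b}. dist u t < d \<longrightarrow>
       dist (integral {0..b} (\<lambda>s. smul (f s) (E (u - s)))) (integral {0..b} (\<lambda>s. smul (f s) (E (t - s)))) < e"
    proof (intro exI[of _ d] conjI ballI impI d(1))
      fix u assume u: "u \<in> {0..b}" "dist u t < d"
      have "integral {0..b} (\<lambda>s. smul (f s) (E (u - s))) - integral {0..b} (\<lambda>s. smul (f s) (E (t - s)))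
          = integral {0..b} (\<lambda>s. smul (f s) (E (u - s) - E (t - s)))"
        using int[OF u(1)] int[OF t] by (simp add: smul.diff_right integral_diff)
      also have "norm \<dots> \<le> B * (e / (B + 1))"
        unfolding B_def
      proof (rule norm_integral_smul_le[OF f])
        show "continuous_on {0..b} (\<lambda>s. E (u - s) - E (t - s))"
          using Ei t u by (intro continuous_on_diff) auto
        fix s assume s: "s \<in> {0..b}"
        have "dist (E (u - s)) (E (t - s)) < e / (B + 1)"
          using s t u by (intro d(2)) (auto simp: dist_norm)
        then show "norm (E (u - s) - E (t - s)) \<le> e / (integral {0..b} (\<lambda>s. norm (f s)) + 1)"
          by (simp add: dist_norm B_def)
      qed
      also have "\<dots> < e" using e B by (simp add: field_simps)
      finally show "dist (integral {0..b} (\<lambda>s. smul (f s) (E (u - s))))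
          (integral {0..b} (\<lambda>s. smul (f s) (E (t - s)))) < e"
        by (simp add: dist_norm)
    qed
  qed
  moreover have "continuous_on {0..b} (\<lambda>t. integral {t..b} (\<lambda>s. smul (f s) (F 0)))"
    by (intro indefinite_integral_continuous_1' integrable_smul f continuous_intros)
  ultimately have "continuous_on {0..b} (\<lambda>t. integral {0..b} (\<lambda>s. smul (f s) (E (t - s)))
      - integral {t..b} (\<lambda>s. smul (f s) (F 0)))"
    by (rule continuous_on_diff)
  then show ?thesis
    by (rule continuous_on_eq) (simp add: eq)
qed

text \<open>For separable \<open>F\<close> both laws are scalar Fubini, and they extend by density.
  Integrating the vector factor produces vectors in the domain of \<open>A\<close>; integrating the
  kernel produces the form in which different splitting points can be compared.\<close>

lemma integral_vconv:
  assumes f: "f absolutely_integrable_on {0..b}" and F: "continuous_on {0..b} F" and r: "r \<in> {0..b}"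
  shows integral_vconv_right: "integral {0..r} (vconv f F) = vconv f (\<lambda>s. integral {0..s} F) r"
    and integral_vconv_left: "integral {0..r} (vconv f F) = vconv (\<lambda>s. integral {0..s} f) F r"
proof -
  define B where "B = integral {0..b} (\<lambda>s. norm (f s))"
  have B: "0 \<le> B"
    unfolding B_def using f by (intro integral_nonneg) (auto simp: absolutely_integrable_on_def)
  have fi: "f integrable_on {0..b}" using f by (auto simp: absolutely_integrable_on_def)
  have f1: "(\<lambda>s. integral {0..s} f) absolutely_integrable_on {0..b}"
    by (intro absolutely_integrable_continuous_real indefinite_integral_continuous_1 fi)
  define B1 where "B1 = integral {0..b} (\<lambda>s. norm (integral {0..s} f))"
  have Fi: "F integrable_on {0..t}" if "continuous_on {0..b} F" "t \<le> b" for F :: "real \<Rightarrow> 'a" and t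
    using that by (intro integrable_continuous_real) (auto intro: continuous_on_subset)
  have F1: "continuous_on {0..b} (\<lambda>s. integral {0..s} F)" if "continuous_on {0..b} F" for F :: "real \<Rightarrow> 'a"
    using that by (intro indefinite_integral_continuous_1 Fi) auto
  have Ci: "vconv f F integrable_on {0..r}" if "continuous_on {0..b} F" for F
    using continuous_on_vconv[OF f that] r
    by (intro integrable_continuous_real) (auto intro: continuous_on_subset)
  have add: "integral {0..r} (vconv f (\<lambda>s. F s + G s)) = integral {0..r} (vconv f F) + integral {0..r} (vconv f G)"
    if "continuous_on {0..b} F" "continuous_on {0..b} G" for F G
  proof -
    have "integral {0..r} (vconv f (\<lambda>s. F s + G s)) = integral {0..r} (\<lambda>t. vconv f F t + vconv f G t)"
      using r that by (intro integral_cong vconv_add[OF f]) auto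
    then show ?thesis using Ci that by (simp add: integral_add)
  qed
  have bnd: "norm (integral {0..r} (vconv f F)) \<le> B * M * b"
    if "continuous_on {0..b} F" "0 \<le> M" "\<And>s. s \<in> {0..b} \<Longrightarrow> norm (F s) \<le> M" for F M
  proof -
    have "norm (integral {0..r} (vconv f F)) \<le> integral {0..r} (\<lambda>t. B * M)"
      using that norm_vconv_le[OF f that(1) _ that(2,3)] r
      by (intro Henstock_Kurzweil_Integration.integral_norm_bound_integral Ci) (auto simp: B_def)
    also have "\<dots> \<le> B * M * b" using r B that(2) mult_left_mono[of r b "B * M"] by (simp add: mult_ac)
    finally show ?thesis .
  qed
  \<comment> \<open>Embedding the real weight into \<open>'s\<close> turns the vector convolution
    into a scalar one times \<open>v\<close>.\<close>
  have sep: "integral {0..r} (vconv f (\<lambda>s. \<phi> s *\<^sub>R v)) = smul (integral {0..r} (convolution f (\<lambda>s. of_real (\<phi> s)))) v"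
    "(\<lambda>s. of_real (\<phi> s) :: 's) absolutely_integrable_on {0..b}"
    if \<phi>: "continuous_on {0..b} \<phi>" for \<phi> v
  proof -
    have c: "continuous_on {0..b} (\<lambda>s. of_real (\<phi> s) :: 's)"
      using \<phi> by (intro continuous_intros)
    then show abs: "(\<lambda>s. of_real (\<phi> s) :: 's) absolutely_integrable_on {0..b}"
      by (rule absolutely_integrable_continuous_real)
    have "convolution f (\<lambda>s. of_real (\<phi> s)) absolutely_integrable_on {0..r}"
      using absolutely_integrable_convolution(1)[OF f abs] r
      by (auto intro: absolutely_integrable_on_Icc_subset)
    then have "convolution f (\<lambda>s. of_real (\<phi> s)) integrable_on {0..r}"
      by (auto simp: absolutely_integrable_on_def)
    moreover have "integral {0..r} (vconv f (\<lambda>s. \<phi> s *\<^sub>R v))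
        = integral {0..r} (\<lambda>t. smul (convolution f (\<lambda>s. of_real (\<phi> s)) t) v)"
      using r by (intro integral_cong) (simp add: vconv_separable[OF f c] flip: smul_of_real)
    ultimately show "integral {0..r} (vconv f (\<lambda>s. \<phi> s *\<^sub>R v))
        = smul (integral {0..r} (convolution f (\<lambda>s. of_real (\<phi> s)))) v"
      by (simp add: integral_smul_const)
  qed
  let ?L = "\<lambda>F. integral {0..r} (vconv f F) - vconv f (\<lambda>s. integral {0..s} F) r"
  have "?L F = 0"
  \<comment> \<open>\<open>B * b\<close> occurs twice: from integrating the bound
    \<open>B * M\<close> over \<open>{0..r}\<close>, and from bounding the primitive of
    \<open>F\<close> by \<open>M * b\<close>.\<close>
  proof (rule bounded_functional_eq_0_if_eq_0_on_separable[where L = ?L and b = b and C = "B * b + B * b"])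
    fix F G :: "real \<Rightarrow> 'a" assume FG: "continuous_on {0..b} F" "continuous_on {0..b} G"
    have "vconv f (\<lambda>s. integral {0..s} (\<lambda>s. F s + G s)) r
        = vconv f (\<lambda>s. integral {0..s} F + integral {0..s} G) r"
      using r FG by (intro vconv_cong integral_add Fi) auto
    then show "?L (\<lambda>s. F s + G s) = ?L F + ?L G"
      using FG F1 r by (simp add: add vconv_add[OF f])
  next
    fix F :: "real \<Rightarrow> 'a" and M assume F: "continuous_on {0..b} F" "0 \<le> M" "\<And>s. s \<in> {0..b} \<Longrightarrow> norm (F s) \<le> M"
    have "norm (integral {0..s} F) \<le> M * b" if s: "s \<in> {0..b}" for s
    proof -
      have "norm (integral {0..s} F) \<le> integral {0..s} (\<lambda>t. M)"
        using F s by (intro Henstock_Kurzweil_Integration.integral_norm_bound_integral Fi) auto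
      also have "\<dots> \<le> M * b" using s F(2) mult_left_mono[of s b M] by (simp add: mult.commute)
      finally show ?thesis .
    qed
    then have "norm (vconv f (\<lambda>s. integral {0..s} F) r) \<le> B * (M * b)"
      using F(2) r unfolding B_def by (intro norm_vconv_le[OF f F1[OF F(1)]]) auto
    then show "norm (?L F) \<le> (B * b + B * b) * M"
      using bnd[OF F] norm_triangle_ineq4[of "integral {0..r} (vconv f F)" "vconv f (\<lambda>s. integral {0..s} F) r"]
      by (simp add: algebra_simps)
  next
    fix \<phi> :: "real \<Rightarrow> real" and v :: 'a assume \<phi>: "continuous_on {0..b} \<phi>"
    have \<phi>i: "\<phi> integrable_on {0..s}" if "s \<le> b" for s
      using \<phi> that by (intro integrable_continuous_real) (auto intro: continuous_on_subset)
    have int: "integral {0..s} (\<lambda>s. \<phi> s *\<^sub>R v) = smul (of_real (integral {0..s} \<phi>)) v" if "s \<le> b" for s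
      using integral_linear[OF \<phi>i[OF that] bounded_linear_scaleR_left] by (simp add: o_def smul_of_real)
    have int': "of_real (integral {0..s} \<phi>) = integral {0..s} (\<lambda>s. of_real (\<phi> s) :: 's)" if "s \<le> b" for s
      using integral_linear[OF \<phi>i[OF that] bounded_linear_of_real[where 'a = 's]] by (simp add: o_def)
    have "vconv f (\<lambda>s. integral {0..s} (\<lambda>s. \<phi> s *\<^sub>R v)) r
        = vconv f (\<lambda>s. smul (of_real (integral {0..s} \<phi>)) v) r"
      using r by (intro vconv_cong int) auto
    also have "\<dots> = smul (convolution f (\<lambda>s. of_real (integral {0..s} \<phi>)) r) v"
      using r by (intro vconv_separable[OF f] continuous_intros indefinite_integral_continuous_1 \<phi>i) auto
    also have "convolution f (\<lambda>s. of_real (integral {0..s} \<phi>)) r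
        = convolution f (\<lambda>s. integral {0..s} (\<lambda>s. of_real (\<phi> s))) r"
      unfolding convolution_def using r by (intro integral_cong) (simp add: int')
    finally show "?L (\<lambda>s. \<phi> s *\<^sub>R v) = 0"
      using sep(1)[OF \<phi>] integral_convolution_right[OF f sep(2)[OF \<phi>] r] by simp
  qed (rule F)
  then show "integral {0..r} (vconv f F) = vconv f (\<lambda>s. integral {0..s} F) r" by simp
  let ?K = "\<lambda>F. integral {0..r} (vconv f F) - vconv (\<lambda>s. integral {0..s} f) F r"
  have "?K F = 0"
  \<comment> \<open>Now \<open>F\<close> itself is convolved, with the primitive of
    \<open>f\<close>, whose L1 norm is \<open>B1\<close>.\<close>
  proof (rule bounded_functional_eq_0_if_eq_0_on_separable[where L = ?K and b = b and C = "B * b + B1"])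
    fix F G :: "real \<Rightarrow> 'a" assume FG: "continuous_on {0..b} F" "continuous_on {0..b} G"
    then show "?K (\<lambda>s. F s + G s) = ?K F + ?K G"
      using r by (simp add: add vconv_add[OF f1])
  next
    fix F :: "real \<Rightarrow> 'a" and M assume F: "continuous_on {0..b} F" "0 \<le> M" "\<And>s. s \<in> {0..b} \<Longrightarrow> norm (F s) \<le> M"
    have "norm (vconv (\<lambda>s. integral {0..s} f) F r) \<le> B1 * M"
      using F r unfolding B1_def by (intro norm_vconv_le[OF f1]) auto
    then show "norm (?K F) \<le> (B * b + B1) * M"
      using bnd[OF F] norm_triangle_ineq4[of "integral {0..r} (vconv f F)" "vconv (\<lambda>s. integral {0..s} f) F r"]
      by (simp add: algebra_simps)
  next
    fix \<phi> :: "real \<Rightarrow> real" and v :: 'a assume \<phi>: "continuous_on {0..b} \<phi>"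
    have "vconv (\<lambda>s. integral {0..s} f) (\<lambda>s. \<phi> s *\<^sub>R v) r
        = smul (convolution (\<lambda>s. integral {0..s} f) (\<lambda>s. of_real (\<phi> s)) r) v"
      unfolding smul_of_real[symmetric] using r \<phi> by (intro vconv_separable[OF f1] continuous_intros) auto
    then show "?K (\<lambda>s. \<phi> s *\<^sub>R v) = 0"
      using sep(1)[OF \<phi>] absolutely_integrable_convolution(2)[OF f sep(2)[OF \<phi>] r] by simp
  qed (rule F)
  then show "integral {0..r} (vconv f F) = vconv (\<lambda>s. integral {0..s} f) F r" by simp
qed

lemma vconv_split:
  assumes f: "f absolutely_integrable_on {0..a + u}" and F: "continuous_on {0..a + u} F"
    and "0 \<le> a" "0 \<le> u"
  shows "vconv f F (a + u)
    = integral {0..a} (\<lambda>s. smul (f (a + u - s)) (F s)) + vconv f (\<lambda>s. F (a + s)) u"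
proof -
  have "integral {a..a + u} (\<lambda>s. smul (f (a + u - s)) (F s)) = vconv f (\<lambda>s. F (a + s)) u"
    using integral_shift_Icc_real[of 0 u "\<lambda>s. smul (f (a + u - s)) (F s)" a]
    by (simp add: vconv_def o_def add.commute)
  then show ?thesis
    using Henstock_Kurzweil_Integration.integral_combine[OF _ _ integrable_vconv[OF f F order_refl], of a] assms
    by (simp add: vconv_def)
qed

end

subsection \<open>Closed operators and families of operators\<close>

text \<open>Supplies bounds uniform in time for strongly continuous families on compact intervals.
  By Baire one of the closed sets \<open>E n\<close>, which cover the space, contains a
  ball.\<close>

lemma uniform_boundedness_principle:
  fixes P :: "'i \<Rightarrow> 'a::banach \<Rightarrow> 'b::real_normed_vector"
  assumes lin: "\<And>i. i \<in> I \<Longrightarrow> bounded_linear (P i)"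
    and bdd: "\<And>x. bounded ((\<lambda>i. P i x) ` I)"
  obtains M where "0 \<le> M" "\<And>i x. i \<in> I \<Longrightarrow> norm (P i x) \<le> M * norm x"
proof -
  define E where "E n = {x. \<forall>i\<in>I. norm (P i x) \<le> real n}" for n :: nat
  have closed: "closed (E n)" for n
  proof -
    have "E n = (\<Inter>i\<in>I. {x. norm (P i x) \<le> real n})" by (auto simp: E_def)
    then show ?thesis
      by (simp, intro closed_INT ballI closed_Collect_le continuous_on_norm continuous_on_const
          bounded_linear.continuous_on[OF lin] continuous_on_id)
  qed
  have "\<exists>n. interior (E n) \<noteq> {}"
  proof (rule ccontr)
    assume "\<nexists>n. interior (E n) \<noteq> {}"
    then have "(euclidean :: 'a topology) interior_of (\<Union>n. E n) = {}"
      using closed by (intro Baire_category_alt) (auto simp: completely_metrizable_space_euclidean)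
    moreover have "(\<Union>n. E n) = UNIV"
    proof -
      have "\<exists>n. x \<in> E n" for x
      proof -
        obtain B where B: "\<And>i. i \<in> I \<Longrightarrow> norm (P i x) \<le> B"
          using bdd[of x] unfolding bounded_iff by blast
        obtain n where "B \<le> real n" using real_arch_simple by blast
        then show ?thesis using B unfolding E_def by (intro exI[of _ n]) (auto intro: order_trans)
      qed
      then show ?thesis by auto
    qed
    ultimately show False by simp
  qed
  then obtain n x0 e where e: "0 < e" "cball x0 e \<subseteq> E n"
    by (metis ex_in_conv mem_interior_cball)
  show thesis
  \<comment> \<open>A vector \<open>y\<close> of norm \<open>e\<close> is the difference of
    \<open>x0 + y\<close> and \<open>x0\<close>, both in \<open>E n\<close>, so its image has norm
    at most \<open>2 * real n\<close>; the rest is scaling.\<close>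
  proof (rule that[of "2 * real n / e"])
    fix i and x :: 'a assume i: "i \<in> I"
    interpret bounded_linear "P i" by (rule lin[OF i])
    show "norm (P i x) \<le> 2 * real n / e * norm x"
    proof (cases "x = 0")
      case False
      define y where "y = (e / norm x) *\<^sub>R x"
      have "x0 + y \<in> cball x0 e" "x0 \<in> cball x0 e"
        using e(1) False by (auto simp: y_def dist_norm)
      then have "norm (P i (x0 + y)) \<le> real n" "norm (P i x0) \<le> real n"
        using e(2) i unfolding E_def by blast+
      then have "norm (P i y) \<le> 2 * real n"
        using norm_triangle_ineq4[of "P i (x0 + y)" "P i x0"] by (simp add: add)
      then show ?thesis
        using e(1) False by (simp add: y_def scaleR field_simps)
    qed (simp add: zero)
  qed (use e in auto)
qed

text \<open>Riemann sums are linear combinations of values in \<open>V\<close>. The subspace in view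
  is the graph of a closed operator.\<close>

lemma has_integral_in_closed_subspace:
  fixes f :: "'n::euclidean_space \<Rightarrow> 'b::real_normed_vector"
  assumes f: "(f has_integral y) (cbox a b)" and V: "subspace V" "closed V"
    and in_V: "\<And>x. x \<in> cbox a b \<Longrightarrow> f x \<in> V"
  shows "y \<in> V"
proof -
  have "y \<in> closure V"
    unfolding closure_approachable
  proof (intro allI impI)
    fix e :: real assume "0 < e"
    then obtain \<gamma> where \<gamma>: "gauge \<gamma>" "\<And>p. p tagged_division_of cbox a b \<Longrightarrow> \<gamma> fine p \<Longrightarrow>
        norm ((\<Sum>(x, K)\<in>p. measure lborel K *\<^sub>R f x) - y) < e"
      using f unfolding has_integral by metis
    obtain p where p: "p tagged_division_of cbox a b" "\<gamma> fine p"
      using fine_division_exists[OF \<gamma>(1)] by blast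
    have "(\<Sum>(x, K)\<in>p. measure lborel K *\<^sub>R f x) \<in> V"
    proof (intro subspace_sum[OF V(1)], clarify)
      fix x K assume "(x, K) \<in> p"
      then have "f x \<in> V" using in_V tag_in_interval[OF p(1)] by blast
      then show "measure lborel K *\<^sub>R f x \<in> V" by (rule subspace_scale[OF V(1)])
    qed
    then show "\<exists>z\<in>V. dist z y < e"
      using \<gamma>(2)[OF p] by (auto simp: dist_norm)
  qed
  then show ?thesis using V(2) by simp
qed

lemma continuous_eq_if_integral_eq:
  fixes f g :: "real \<Rightarrow> 'b::banach"
  assumes "continuous_on {0..b} f" "continuous_on {0..b} g" "0 < b" "t \<in> {0..b}"
    and eq: "\<And>t. t \<in> {0..b} \<Longrightarrow> integral {0..t} f = integral {0..t} g"
  shows "f t = g t"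
proof -
  have "((\<lambda>u. integral {0..u} f) has_vector_derivative f t) (at t within {0..b})"
    using assms by (intro integral_has_vector_derivative)
  moreover have "((\<lambda>u. integral {0..u} f) has_vector_derivative g t) (at t within {0..b})"
    by (rule has_vector_derivative_transform[OF assms(4) _
          integral_has_vector_derivative[OF assms(2,4)]]) (simp add: eq)
  ultimately show ?thesis
    using assms(3,4) vector_derivative_unique_within_closed_interval[of 0 b t] by simp
qed

context banach_space_over
begin

text \<open>The pair \<open>(\<Phi> s, A (\<Phi> s))\<close> stays in the graph of \<open>A\<close>,
  a closed real subspace of the product space, hence so does its integral.\<close>

lemma closed_operator_has_integral:
  fixes \<Phi> :: "real \<Rightarrow> 'a"
  assumes A: "closed_linear_operator smul D A"
    and "(\<Phi> has_integral y) {a..b}" "((\<lambda>s. A (\<Phi> s)) has_integral z) {a..b}"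
    and D: "\<And>s. s \<in> {a..b} \<Longrightarrow> \<Phi> s \<in> D"
  shows "y \<in> D \<and> A y = z"
proof -
  let ?\<Gamma> = "{(x, A x) | x. x \<in> D}"
  have sub: "subspace D" and add: "\<And>x y. x \<in> D \<Longrightarrow> y \<in> D \<Longrightarrow> A (x + y) = A x + A y"
    and scale: "\<And>c x. x \<in> D \<Longrightarrow> A (smul c x) = smul c (A x)"
    and closed: "closed ?\<Gamma>"
    using A by (auto simp: closed_linear_operator_def)
  have "A 0 = 0" using scale[of 0 0] subspace_0[OF sub] by simp
  have sub_\<Gamma>: "Real_Vector_Spaces.subspace ?\<Gamma>"
    unfolding Real_Vector_Spaces.subspace_def
  proof (intro conjI ballI allI)
    show "0 \<in> ?\<Gamma>" using subspace_0[OF sub] \<open>A 0 = 0\<close> by (auto simp: zero_prod_def)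
    show "u + v \<in> ?\<Gamma>" if "u \<in> ?\<Gamma>" "v \<in> ?\<Gamma>" for u v
      using that by (auto simp: add subspace_add[OF sub])
    show "c *\<^sub>R u \<in> ?\<Gamma>" if "u \<in> ?\<Gamma>" for c u
      using that scale[of _ "of_real c"] subspace_scale[OF sub, of _ "of_real c"]
      by (auto simp: smul_of_real)
  qed
  have "((\<lambda>s. (\<Phi> s, A (\<Phi> s))) has_integral (y, z)) {a..b}"
  proof -
    have "((\<lambda>s. (\<Phi> s, 0)) has_integral (y, 0)) {a..b}"
      using has_integral_linear[OF assms(2), of "\<lambda>x. (x, 0)"]
      by (simp add: o_def bounded_linear_Pair bounded_linear_ident bounded_linear_zero)
    moreover have "((\<lambda>s. (0, A (\<Phi> s))) has_integral (0, z)) {a..b}"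
      using has_integral_linear[OF assms(3), of "\<lambda>x. (0, x)"]
      by (simp add: o_def bounded_linear_Pair bounded_linear_ident bounded_linear_zero)
    ultimately have "((\<lambda>s. (\<Phi> s, 0) + (0, A (\<Phi> s))) has_integral (y, 0) + (0, z)) {a..b}"
      by (rule has_integral_add)
    then show ?thesis by simp
  qed
  then have "((\<lambda>s. (\<Phi> s, A (\<Phi> s))) has_integral (y, z)) (cbox a b)" by simp
  then have "(y, z) \<in> ?\<Gamma>"
  proof (rule has_integral_in_closed_subspace[OF _ sub_\<Gamma> closed])
    fix s assume "s \<in> cbox a b"
    then have "\<Phi> s \<in> D" using D by simp
    then show "(\<Phi> s, A (\<Phi> s)) \<in> ?\<Gamma>" by blast
  qed
  then show ?thesis by auto
qed

lemma closed_operator_vconv: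
  assumes A: "closed_linear_operator smul D A" and f: "f absolutely_integrable_on {0..b}"
    and \<Phi>: "continuous_on {0..b} \<Phi>" "continuous_on {0..b} (\<lambda>s. A (\<Phi> s))"
    and D: "\<And>s. s \<in> {0..b} \<Longrightarrow> \<Phi> s \<in> D" and t: "t \<le> b"
  shows "vconv f \<Phi> t \<in> D \<and> A (vconv f \<Phi> t) = vconv f (\<lambda>s. A (\<Phi> s)) t"
proof (rule closed_operator_has_integral[OF A])
  have sub: "subspace D" and scale: "\<And>c x. x \<in> D \<Longrightarrow> A (smul c x) = smul c (A x)"
    using A by (auto simp: closed_linear_operator_def)
  show "((\<lambda>s. smul (f (t - s)) (\<Phi> s)) has_integral vconv f \<Phi> t) {0..t}"
    using integrable_vconv[OF f \<Phi>(1) t] by (simp add: vconv_def has_integral_integral)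
  have "((\<lambda>s. smul (f (t - s)) (A (\<Phi> s))) has_integral vconv f (\<lambda>s. A (\<Phi> s)) t) {0..t}"
    using integrable_vconv[OF f \<Phi>(2) t] by (simp add: vconv_def has_integral_integral)
  then show "((\<lambda>s. A (smul (f (t - s)) (\<Phi> s))) has_integral vconv f (\<lambda>s. A (\<Phi> s)) t) {0..t}"
    by (rule has_integral_eq[rotated]) (use D t scale in auto)
  show "smul (f (t - s)) (\<Phi> s) \<in> D" if "s \<in> {0..t}" for s
    using D t that by (intro subspace_scale[OF sub]) auto
qed

text \<open>Strong continuity bounds each orbit on the compact interval; uniform boundedness turns
  this into one constant \<open>M\<close>, which bounds the convolution.\<close>

lemma bounded_linear_vconv:
  fixes Q :: "real \<Rightarrow> 'a \<Rightarrow> 'a"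
  assumes f: "f absolutely_integrable_on {0..b}" and t: "t \<le> b"
    and lin: "\<And>s. s \<in> {0..b} \<Longrightarrow> bounded_linear (Q s)"
    and cont: "\<And>x. continuous_on {0..b} (\<lambda>s. Q s x)"
  shows "bounded_linear (\<lambda>x. vconv f (\<lambda>s. Q s x) t)"
proof -
  have "bounded ((\<lambda>s. Q s x) ` {0..b})" for x
    using cont by (intro compact_imp_bounded compact_continuous_image) auto
  then obtain M where M: "0 \<le> M" "\<And>s x. s \<in> {0..b} \<Longrightarrow> norm (Q s x) \<le> M * norm x"
    using uniform_boundedness_principle[of "{0..b}" Q] lin by metis
  show ?thesis
  proof (rule bounded_linear_intro)
    fix x y
    have "vconv f (\<lambda>s. Q s (x + y)) t = vconv f (\<lambda>s. Q s x + Q s y) t"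
      using t lin by (intro vconv_cong) (auto simp: linear_simps)
    then show "vconv f (\<lambda>s. Q s (x + y)) t = vconv f (\<lambda>s. Q s x) t + vconv f (\<lambda>s. Q s y) t"
      using vconv_add[OF f cont cont t] by simp
  next
    fix r x
    have "vconv f (\<lambda>s. Q s (r *\<^sub>R x)) t = vconv f (\<lambda>s. smul (of_real r) (Q s x)) t"
      using t lin by (intro vconv_cong) (auto simp: linear_simps smul_of_real)
    then show "vconv f (\<lambda>s. Q s (r *\<^sub>R x)) t = r *\<^sub>R vconv f (\<lambda>s. Q s x) t"
      using vconv_smul[OF f cont t, of "of_real r" x] unfolding smul_of_real by simp
  next
    fix x
    have "norm (vconv f (\<lambda>s. Q s x) t) \<le> integral {0..b} (\<lambda>s. norm (f s)) * (M * norm x)"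
      using M by (intro norm_vconv_le[OF f cont t]) auto
    then show "norm (vconv f (\<lambda>s. Q s x) t) \<le> norm x * (integral {0..b} (\<lambda>s. norm (f s)) * M)"
      by (simp add: mult_ac)
  qed
qed

text \<open>Convolution commutes with a delay by \<open>a\<close>: since \<open>g 0 = 0\<close>, the
  delayed function vanishes on \<open>{0..a}\<close> and only the shifted part of the integral
  remains.\<close>

lemma vconv_delay:
  assumes f: "f absolutely_integrable_on {0..a + r}" and g: "continuous_on {0..r} g" "g 0 = 0"
    and a: "0 \<le> a" and t: "t \<in> {0..a + r}"
  shows "vconv f (\<lambda>s. g (max 0 (s - a))) t = vconv f g (max 0 (t - a))"
proof (cases "t \<le> a")
  case True
  then have "vconv f (\<lambda>s. g (max 0 (s - a))) t = integral {0..t} (\<lambda>s. 0)"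
    unfolding vconv_def using g(2) by (intro integral_cong) auto
  then show ?thesis using True by simp
next
  case False
  define u where "u = t - a"
  have u: "0 \<le> u" "u \<le> r" "t = a + u" using False t by (auto simp: u_def)
  have "continuous_on {0..a + u} (\<lambda>s. g (max 0 (s - a)))"
    using u by (intro continuous_on_compose2[OF g(1)]) (auto intro!: continuous_intros)
  then have "vconv f (\<lambda>s. g (max 0 (s - a))) (a + u)
      = integral {0..a} (\<lambda>s. smul (f (a + u - s)) (g (max 0 (s - a)))) + vconv f (\<lambda>s. g (max 0 (a + s - a))) u"
    using f u a by (intro vconv_split) (auto intro: absolutely_integrable_on_Icc_subset)
  also have "integral {0..a} (\<lambda>s. smul (f (a + u - s)) (g (max 0 (s - a)))) = integral {0..a} (\<lambda>s. 0)"
    using g(2) by (intro integral_cong) auto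
  also have "vconv f (\<lambda>s. g (max 0 (a + s - a))) u = vconv f g u"
    by (intro vconv_cong) auto
  finally show ?thesis using u by simp
qed

lemma integral_delay:
  fixes g :: "real \<Rightarrow> 'a"
  assumes g: "continuous_on {0..r} g" "g 0 = 0" and a: "0 \<le> a" and t: "t \<in> {0..a + r}"
  shows "integral {0..t} (\<lambda>s. g (max 0 (s - a))) = integral {0..max 0 (t - a)} g"
proof -
  \<comment> \<open>Integration is convolution with the constant kernel 1, so the previous lemma
    applies.\<close>
  have *: "vconv (\<lambda>s. 1) h s = integral {0..s} h" for h s
    by (simp add: vconv_def)
  have "(\<lambda>s. 1 :: 's) absolutely_integrable_on {0..a + r}"
    by (intro absolutely_integrable_continuous_real continuous_intros)
  from vconv_delay[OF this g a t] show ?thesis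
    by (simp only: *)
qed

end

subsection \<open>Extending a convoluted semigroup\<close>

context banach_space_over
begin

lemma local_convoluted_semigroup_restrict:
  assumes "local_convoluted_semigroup smul I k D A S" "{0..b} \<subseteq> I" "0 < b"
  shows "local_convoluted_semigroup smul {0..b} k D A S"
proof -
  have "time_interval {0..b}"
    using assms(3) by (auto simp: time_interval_def)
  moreover have "locally_integrable_on k {0..b}"
    using assms(1,2) unfolding local_convoluted_semigroup_def locally_integrable_on_def by blast
  moreover have "continuous_on {0..b} (\<lambda>t. S t x)" for x
    using assms(1) continuous_on_subset[OF _ assms(2)] unfolding local_convoluted_semigroup_def by blast
  ultimately show ?thesis
    using assms(1,2) unfolding local_convoluted_semigroup_def by (simp add: subset_iff)
qed

context
  fixes I k D A S
  assumes S: "local_convoluted_semigroup smul I k D A S"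
begin

lemma semigroup_closed: "closed_linear_operator smul D A"
  and semigroup_bounded_linear: "t \<in> I \<Longrightarrow> bounded_linear (S t)"
  and semigroup_smul: "t \<in> I \<Longrightarrow> S t (smul c x) = smul c (S t x)"
  and semigroup_continuous: "continuous_on I (\<lambda>t. S t x)"
  and semigroup_domain: "t \<in> I \<Longrightarrow> x \<in> D \<Longrightarrow> S t x \<in> D"
  and semigroup_commute: "t \<in> I \<Longrightarrow> x \<in> D \<Longrightarrow> A (S t x) = S t (A x)"
  and semigroup_integral_domain: "t \<in> I \<Longrightarrow> integral {0..t} (\<lambda>s. S s x) \<in> D"
  and semigroup_generator: "t \<in> I \<Longrightarrow>
    A (integral {0..t} (\<lambda>s. S s x)) = S t x - smul (integral {0..t} k) x"
  using S unfolding local_convoluted_semigroup_def by blast+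

lemma operator_domain: "subspace D"
  and operator_add: "x \<in> D \<Longrightarrow> y \<in> D \<Longrightarrow> A (x + y) = A x + A y"
  and operator_smul: "x \<in> D \<Longrightarrow> A (smul c x) = smul c (A x)"
  using semigroup_closed unfolding closed_linear_operator_def by blast+

lemma operator_diff:
  assumes "x \<in> D" "y \<in> D" shows "A (x - y) = A x - A y"
  using operator_add[OF assms(1) subspace_scale[OF operator_domain assms(2)], of "- 1"]
    operator_smul[OF assms(2), of "- 1"] by simp

end

text \<open>One step of the recursion, with the previous family \<open>P\<close> and its kernel
  \<open>p\<close> left free. The splitting point \<open>a\<close> is a separate parameter so that
  the same \<open>P\<close> can also be split earlier.\<close>

definition extension ::
    "(real \<Rightarrow> 's) \<Rightarrow> (real \<Rightarrow> 's) \<Rightarrow> (real \<Rightarrow> 'a \<Rightarrow> 'a) \<Rightarrow> (real \<Rightarrow> 'a \<Rightarrow> 'a) \<Rightarrow> real \<Rightarrow> real \<Rightarrow> 'a \<Rightarrow> 'a"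
  where "extension k p S P a t x = (if t \<le> a then vconv k (\<lambda>s. P s x) t else
     P a (S (t - a) x) + integral {0..a} (\<lambda>s. smul (k (t - s)) (P s x))
     + integral {0..t - a} (\<lambda>s. smul (p (t - s)) (S s x)))"

text \<open>The families for two values of \<open>\<kappa>\<close> are known to agree only up to the
  smaller end point; the extension reads \<open>P\<close> nowhere else.\<close>

lemma extension_cong:
  assumes "0 \<le> a" "\<And>s y. s \<in> {0..a} \<Longrightarrow> P s y = Q s y"
  shows "extension k p S P a t x = extension k p S Q a t x"
proof -
  have "vconv k (\<lambda>s. P s x) t = vconv k (\<lambda>s. Q s x) t" if "t \<le> a"
    using that assms(2) by (intro vconv_cong) auto
  moreover have "integral {0..a} (\<lambda>s. smul (k (t - s)) (P s x)) = integral {0..a} (\<lambda>s. smul (k (t - s)) (Q s x))"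
    using assms(2) by (intro integral_cong) auto
  ultimately show ?thesis using assms by (simp add: extension_def)
qed

end

text \<open>In the recursion \<open>a\<close> is \<open>(m + 1) * \<kappa>\<close> and
  \<open>r\<close> is \<open>\<kappa>\<close>. Keeping both free allows a second instance with the
  same families and smaller \<open>a\<close> and \<open>r\<close>.\<close>

locale semigroup_extension = banach_space_over smul
  for smul :: "'s::{real_normed_field, euclidean_space} \<Rightarrow> 'a::banach \<Rightarrow> 'a" +
  fixes k p :: "real \<Rightarrow> 's" and D :: "'a set" and A :: "'a \<Rightarrow> 'a"
    and S P :: "real \<Rightarrow> 'a \<Rightarrow> 'a" and a r :: real
  assumes a: "0 < a" and r: "0 < r"
    and k: "k absolutely_integrable_on {0..a + r}" and p: "p absolutely_integrable_on {0..a + r}"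
    and S: "local_convoluted_semigroup smul {0..r} k D A S"
    and P: "local_convoluted_semigroup smul {0..a} p D A P"
begin

abbreviation R where "R \<equiv> extension k p S P a"

abbreviation K where "K t \<equiv> integral {0..t} k"
abbreviation Kp where "Kp t \<equiv> integral {0..t} p"
abbreviation pa where "pa s \<equiv> p (a + s)"
abbreviation H where "H t x \<equiv> integral {0..t} (\<lambda>s. S s x)"
abbreviation G where "G t x \<equiv> integral {0..t} (\<lambda>s. P s x)"
abbreviation u where "u t \<equiv> max 0 (t - a)"

lemma u_in: "t \<in> {0..a + r} \<Longrightarrow> u t \<in> {0..r}"
  using r by auto

lemma k': "b \<le> a + r \<Longrightarrow> k absolutely_integrable_on {0..b}"
  and p': "b \<le> a + r \<Longrightarrow> p absolutely_integrable_on {0..b}"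
  using k p by (auto intro: absolutely_integrable_on_Icc_subset)

lemma pa: "pa absolutely_integrable_on {0..r}"
  using p a by (intro absolutely_integrable_on_shift_Icc) (auto intro: absolutely_integrable_on_Icc_subset)

lemma k_int: "b \<le> a + r \<Longrightarrow> k integrable_on {0..b}"
  and p_int: "b \<le> a + r \<Longrightarrow> p integrable_on {0..b}"
  using k' p' by (auto simp: absolutely_integrable_on_def)

lemma pa_int: "b \<le> r \<Longrightarrow> pa integrable_on {0..b}"
  using absolutely_integrable_on_Icc_subset[OF pa, of 0 b] by (auto simp: absolutely_integrable_on_def)

lemma K_cont: "continuous_on {0..a + r} K" and Kp_cont: "continuous_on {0..a + r} Kp"
  by (auto intro: indefinite_integral_continuous_1 k_int p_int)

lemma S_0 [simp]: "S 0 x = 0" and P_0 [simp]: "P 0 x = 0"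
  by (rule local_convoluted_semigroup_0[OF banach_space_over_axioms S]
      local_convoluted_semigroup_0[OF banach_space_over_axioms P])+

lemma P_min_cont: "continuous_on X (\<lambda>s. P (min s a) x)" if "X \<subseteq> {0..}"
  by (rule continuous_on_compose2[OF semigroup_continuous[OF P]])
    (use a that in \<open>auto intro!: continuous_intros\<close>)

lemma S_u_cont: "continuous_on {0..a + r} (\<lambda>t. S (u t) x)"
  by (rule continuous_on_compose2[OF semigroup_continuous[OF S]])
    (use r in \<open>auto intro!: continuous_intros\<close>)

lemma K_u_cont: "continuous_on {0..a + r} (\<lambda>t. K (u t))"
  by (rule continuous_on_compose2[OF K_cont]) (use a r in \<open>auto intro!: continuous_intros\<close>)

lemma Pa_linear: "bounded_linear (P a)"
  using semigroup_bounded_linear[OF P] a by simp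

text \<open>The constant tail over \<open>[a, a + t]\<close> contributes the second summand; for
  \<open>f = k\<close> this is what \<open>R_eq\<close> subtracts through \<open>K\<close>. The case
  \<open>f = K\<close> is used for the integral of \<open>R\<close>.\<close>

lemma vconv_P_min:
  assumes "f absolutely_integrable_on {0..a + r}" "t \<in> {0..r}"
  shows "vconv f (\<lambda>s. P (min s a) x) (a + t)
    = integral {0..a} (\<lambda>s. smul (f (a + t - s)) (P s x)) + smul (integral {0..t} f) (P a x)"
proof -
  have "integral {0..a} (\<lambda>s. smul (f (a + t - s)) (P (min s a) x))
      = integral {0..a} (\<lambda>s. smul (f (a + t - s)) (P s x))"
    by (intro integral_cong) auto
  moreover have "vconv f (\<lambda>s. P (min (a + s) a) x) t = vconv f (\<lambda>s. P a x) t"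
    by (intro vconv_cong) auto
  moreover have "f integrable_on {0..t}"
    using absolutely_integrable_on_Icc_subset[OF assms(1), of 0 t] assms(2) a
    by (auto simp: absolutely_integrable_on_def)
  ultimately show ?thesis
    using assms a vconv_split[of a t f "\<lambda>s. P (min s a) x"] absolutely_integrable_on_Icc_subset[OF assms(1)]
    by (simp add: P_min_cont vconv_const)
qed

text \<open>The two cases of \<open>R\<close> in one formula; extending \<open>P\<close> beyond \<open>a\<close> by the constant \<open>P a\<close> turns
  the integral over \<open>[0, a]\<close> into a convolution on all of \<open>[0, a + r]\<close>.\<close>

lemma R_eq:
  assumes t: "t \<in> {0..a + r}"
  shows "R t x = vconv k (\<lambda>s. P (min s a) x) t + P a (S (u t) x - smul (K (u t)) x)
    + vconv pa (\<lambda>s. S s x) (u t)"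
proof (cases "t \<le> a")
  case True
  \<comment> \<open>All terms in \<open>u\<close> vanish, because \<open>S 0 x = 0\<close> and
    integrals over \<open>{0..0}\<close> are zero.\<close>
  then have "u t = 0" by simp
  moreover have "vconv k (\<lambda>s. P (min s a) x) t = vconv k (\<lambda>s. P s x) t"
    using True by (intro vconv_cong) auto
  ultimately show ?thesis
    using True linear_simps(3)[OF Pa_linear] by (simp add: extension_def)
next
  case False
  define v where "v = t - a"
  have v: "v \<in> {0..r}" "t = a + v" "u t = v" using False t by (auto simp: v_def)
  have "integral {0..t - a} (\<lambda>s. smul (p (t - s)) (S s x)) = vconv pa (\<lambda>s. S s x) v"
    unfolding vconv_def v(2) by (simp add: algebra_simps)
  moreover have "P a (S v x - smul (K v) x) = P a (S v x) - smul (K v) (P a x)"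
    using semigroup_smul[OF P] a by (simp add: linear_simps(2)[OF Pa_linear])
  ultimately show ?thesis
    using False vconv_P_min[OF k v(1)] v(2,3) by (simp add: extension_def)
qed

text \<open>The two cases need no gluing at \<open>a\<close>: each summand of the single formula is
  continuous on the whole interval.\<close>

lemma R_cont: "continuous_on {0..a + r} (\<lambda>t. R t x)"
proof -
  have "continuous_on {0..a + r} (\<lambda>t. P a (S (u t) x - smul (K (u t)) x))"
    by (intro bounded_linear.continuous_on[OF Pa_linear] continuous_on_diff S_u_cont
        smul.continuous_on K_u_cont continuous_on_const)
  moreover have "continuous_on {0..a + r} (\<lambda>t. vconv pa (\<lambda>s. S s x) (u t))"
    by (rule continuous_on_compose2[OF continuous_on_vconv[OF pa semigroup_continuous[OF S]]])
      (use r in \<open>auto intro!: continuous_intros\<close>)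
  moreover have "continuous_on {0..a + r} (vconv k (\<lambda>s. P (min s a) x))"
    by (rule continuous_on_vconv[OF k P_min_cont]) auto
  ultimately show ?thesis
    by (subst continuous_on_cong[OF refl R_eq]) (auto intro!: continuous_on_add)
qed

lemma R_linear:
  assumes t: "t \<in> {0..a + r}"
  shows "bounded_linear (R t)"
proof -
  have S_u: "bounded_linear (S (u t))"
    by (rule semigroup_bounded_linear[OF S u_in[OF t]])
  have "bounded_linear (\<lambda>x. vconv k (\<lambda>s. P (min s a) x) t)"
    by (rule bounded_linear_vconv[OF k]) (use t a in \<open>auto intro!: semigroup_bounded_linear[OF P] P_min_cont\<close>)
  moreover have "bounded_linear (\<lambda>x. vconv pa (\<lambda>s. S s x) (u t))"
    by (rule bounded_linear_vconv[OF pa])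
      (use u_in[OF t] in \<open>auto intro!: semigroup_bounded_linear[OF S] semigroup_continuous[OF S]\<close>)
  moreover have "bounded_linear (\<lambda>x. P a (S (u t) x - smul (K (u t)) x))"
    by (intro bounded_linear_compose[OF Pa_linear] bounded_linear_sub S_u smul.bounded_linear_right)
  ultimately show ?thesis
    unfolding ext[of "R t", OF R_eq[OF t]] by (intro bounded_linear_add)
qed

lemma R_smul:
  assumes t: "t \<in> {0..a + r}"
  shows "R t (smul c x) = smul c (R t x)"
proof -
  have "vconv k (\<lambda>s. P (min s a) (smul c x)) t = vconv k (\<lambda>s. smul c (P (min s a) x)) t"
    using a by (intro vconv_cong semigroup_smul[OF P]) auto
  also have "\<dots> = smul c (vconv k (\<lambda>s. P (min s a) x) t)"
    using t by (intro vconv_smul[OF k] P_min_cont) auto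
  finally have 1: "vconv k (\<lambda>s. P (min s a) (smul c x)) t = smul c (vconv k (\<lambda>s. P (min s a) x) t)" .
  have "vconv pa (\<lambda>s. S s (smul c x)) (u t) = vconv pa (\<lambda>s. smul c (S s x)) (u t)"
    using u_in[OF t] by (intro vconv_cong semigroup_smul[OF S]) auto
  also have "\<dots> = smul c (vconv pa (\<lambda>s. S s x) (u t))"
    using u_in[OF t] by (intro vconv_smul[OF pa] semigroup_continuous[OF S]) auto
  finally have 2: "vconv pa (\<lambda>s. S s (smul c x)) (u t) = smul c (vconv pa (\<lambda>s. S s x) (u t))" .
  have "S (u t) (smul c x) - smul (K (u t)) (smul c x) = smul c (S (u t) x - smul (K (u t)) x)"
    unfolding semigroup_smul[OF S u_in[OF t]] scale_right_diff_distrib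
    by (simp add: mult.commute)
  then have 3: "P a (S (u t) (smul c x) - smul (K (u t)) (smul c x)) = smul c (P a (S (u t) x - smul (K (u t)) x))"
    using semigroup_smul[OF P, of a] a by simp
  show ?thesis
    unfolding R_eq[OF t] 1 2 3 by (simp add: scale_right_distrib)
qed

text \<open>\<open>A\<close> passes through the convolutions because commutation turns
  \<open>A (P s x)\<close> into \<open>P s (A x)\<close>, which is continuous in \<open>s\<close>;
  likewise for \<open>S\<close>.\<close>

lemma R_commute:
  assumes t: "t \<in> {0..a + r}" and x: "x \<in> D"
  shows "R t x \<in> D \<and> A (R t x) = R t (A x)"
proof -
  note sub = operator_domain[OF S]
  have 1: "vconv k (\<lambda>s. P (min s a) x) t \<in> D \<and>
      A (vconv k (\<lambda>s. P (min s a) x) t) = vconv k (\<lambda>s. P (min s a) (A x)) t"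
  proof -
    have AP: "A (P (min s a) x) = P (min s a) (A x)" if "s \<in> {0..a + r}" for s
      using that a by (intro semigroup_commute[OF P] x) auto
    have "vconv k (\<lambda>s. P (min s a) x) t \<in> D \<and>
        A (vconv k (\<lambda>s. P (min s a) x) t) = vconv k (\<lambda>s. A (P (min s a) x)) t"
    proof (rule closed_operator_vconv[OF semigroup_closed[OF S] k])
      show "continuous_on {0..a + r} (\<lambda>s. A (P (min s a) x))"
        using P_min_cont[of "{0..a + r}" "A x"] by (subst continuous_on_cong[OF refl AP]) auto
    qed (use t a in \<open>auto intro!: P_min_cont semigroup_domain[OF P] x\<close>)
    moreover have "vconv k (\<lambda>s. A (P (min s a) x)) t = vconv k (\<lambda>s. P (min s a) (A x)) t"
      using t by (intro vconv_cong AP) auto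
    ultimately show ?thesis by simp
  qed
  have 2: "vconv pa (\<lambda>s. S s x) (u t) \<in> D \<and>
      A (vconv pa (\<lambda>s. S s x) (u t)) = vconv pa (\<lambda>s. S s (A x)) (u t)"
  proof -
    have AS: "A (S s x) = S s (A x)" if "s \<in> {0..r}" for s
      using that by (intro semigroup_commute[OF S] x)
    have "vconv pa (\<lambda>s. S s x) (u t) \<in> D \<and>
        A (vconv pa (\<lambda>s. S s x) (u t)) = vconv pa (\<lambda>s. A (S s x)) (u t)"
    proof (rule closed_operator_vconv[OF semigroup_closed[OF S] pa])
      show "continuous_on {0..r} (\<lambda>s. A (S s x))"
        using semigroup_continuous[OF S, of "A x"] by (subst continuous_on_cong[OF refl AS]) auto
    qed (use u_in[OF t] in \<open>auto intro!: semigroup_continuous[OF S] semigroup_domain[OF S] x\<close>)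
    moreover have "vconv pa (\<lambda>s. A (S s x)) (u t) = vconv pa (\<lambda>s. S s (A x)) (u t)"
      using u_in[OF t] by (intro vconv_cong AS) auto
    ultimately show ?thesis by simp
  qed
  have z: "S (u t) x - smul (K (u t)) x \<in> D"
    by (intro subspace_diff[OF sub] subspace_scale[OF sub] semigroup_domain[OF S u_in[OF t]] x)
  have "A (S (u t) x - smul (K (u t)) x) = S (u t) (A x) - smul (K (u t)) (A x)"
    using semigroup_domain[OF S u_in[OF t] x] subspace_scale[OF sub x]
    by (simp only: operator_diff[OF S] operator_smul[OF S x] semigroup_commute[OF S u_in[OF t] x])
  then have 3: "P a (S (u t) x - smul (K (u t)) x) \<in> D \<and>
      A (P a (S (u t) x - smul (K (u t)) x)) = P a (S (u t) (A x) - smul (K (u t)) (A x))"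
    using semigroup_domain[OF P _ z, of a] semigroup_commute[OF P _ z, of a] a by simp
  show ?thesis
    unfolding R_eq[OF t] using 1 2 3
    by (simp add: operator_add[OF S] subspace_add[OF sub])
qed

text \<open>The functions of \<open>u\<close> vanish at 0, so \<open>integral_delay\<close> moves
  their integrals to \<open>u t\<close>. The convolutions stay unevaluated because
  \<open>integral_R\<close> integrates their vector factor and \<open>integral_R_J\<close> their
  kernel.\<close>

lemma integral_R_parts:
  assumes t: "t \<in> {0..a + r}"
  shows "integral {0..t} (\<lambda>s. R s x) = integral {0..t} (vconv k (\<lambda>s. P (min s a) x))
    + P a (H (u t) x - smul (integral {0..u t} K) x) + integral {0..u t} (vconv pa (\<lambda>s. S s x))"
proof -
  have sub: "{0..t} \<subseteq> {0..a + r}" using t by auto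
  have c1: "continuous_on {0..a + r} (vconv k (\<lambda>s. P (min s a) x))"
    by (rule continuous_on_vconv[OF k P_min_cont]) auto
  have cK: "continuous_on {0..r} K"
    using K_cont by (rule continuous_on_subset) (use a in auto)
  have c2: "continuous_on {0..r} (\<lambda>s. P a (S s x - smul (K s) x))"
    by (intro bounded_linear.continuous_on[OF Pa_linear] continuous_on_diff semigroup_continuous[OF S]
        smul.continuous_on cK continuous_on_const)
  have c3: "continuous_on {0..r} (vconv pa (\<lambda>s. S s x))"
    by (rule continuous_on_vconv[OF pa semigroup_continuous[OF S]])
  have u_cont: "continuous_on {0..a + r} (\<lambda>t. g (u t))" if "continuous_on {0..r} g" for g :: "real \<Rightarrow> 'a"
    by (rule continuous_on_compose2[OF that]) (use r in \<open>auto intro!: continuous_intros\<close>)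
  note ints = continuous_on_subset[OF c1 sub, THEN integrable_continuous_real]
    continuous_on_subset[OF u_cont[OF c2] sub, THEN integrable_continuous_real]
    continuous_on_subset[OF u_cont[OF c3] sub, THEN integrable_continuous_real]
  have "integral {0..t} (\<lambda>s. R s x) = integral {0..t} (\<lambda>s. vconv k (\<lambda>s. P (min s a) x) s
      + P a (S (u s) x - smul (K (u s)) x) + vconv pa (\<lambda>s. S s x) (u s))"
    using t by (intro integral_cong R_eq) auto
  also have "\<dots> = integral {0..t} (vconv k (\<lambda>s. P (min s a) x))
      + integral {0..t} (\<lambda>s. P a (S (u s) x - smul (K (u s)) x))
      + integral {0..t} (\<lambda>s. vconv pa (\<lambda>s. S s x) (u s))"
    using ints by (simp add: integral_add integrable_add)
  also have "integral {0..t} (\<lambda>s. P a (S (u s) x - smul (K (u s)) x))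
      = integral {0..u t} (\<lambda>s. P a (S s x - smul (K s) x))"
    using a t linear_simps(3)[OF Pa_linear] by (intro integral_delay[OF c2]) auto
  also have "\<dots> = P a (integral {0..u t} (\<lambda>s. S s x - smul (K s) x))"
  proof -
    have "(\<lambda>s. S s x - smul (K s) x) integrable_on {0..u t}"
      by (rule integrable_continuous_real, rule continuous_on_subset[of "{0..r}"])
        (use u_in[OF t] in \<open>auto intro!: continuous_on_diff semigroup_continuous[OF S]
        smul.continuous_on cK continuous_on_const\<close>)
    from integral_linear[OF this Pa_linear] show ?thesis by (simp add: o_def)
  qed
  also have "integral {0..u t} (\<lambda>s. S s x - smul (K s) x) = H (u t) x - smul (integral {0..u t} K) x"
  proof -
    have Ki: "K integrable_on {0..u t}"
      by (rule integrable_continuous_real, rule continuous_on_subset[OF cK]) (use u_in[OF t] in auto)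
    have "(\<lambda>s. smul (K s) x) integrable_on {0..u t}"
      using integrable_linear[OF Ki smul.bounded_linear_left] by (simp add: o_def)
    moreover have "(\<lambda>s. S s x) integrable_on {0..u t}"
      by (rule integrable_continuous_real, rule continuous_on_subset[OF semigroup_continuous[OF S]])
        (use u_in[OF t] in auto)
    ultimately show ?thesis using Ki by (simp add: integral_diff integral_smul_const)
  qed
  also have "integral {0..t} (\<lambda>s. vconv pa (\<lambda>s. S s x) (u s)) = integral {0..u t} (vconv pa (\<lambda>s. S s x))"
    using a t by (intro integral_delay[OF c3]) auto
  finally show ?thesis .
qed

end

text \<open>A product rule for \<open>G\<close> differentiable only along the fixed vector
  \<open>y b\<close>. In \<open>G s (y s - y b)\<close> the uniform bound \<open>M\<close> handles
  the remainder of \<open>y\<close>, and strong continuity handles the linear part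
  \<open>(s - b) *\<^sub>R G s y'\<close>.\<close>

lemma has_vector_derivative_strong_product:
  fixes G :: "real \<Rightarrow> 'b::real_normed_vector \<Rightarrow> 'c::real_normed_vector"
  assumes lin: "\<And>s. s \<in> X \<Longrightarrow> bounded_linear (G s)"
    and bound: "\<And>s z. s \<in> X \<Longrightarrow> norm (G s z) \<le> M * norm z" and M: "0 \<le> M"
    and G: "((\<lambda>s. G s (y b)) has_vector_derivative g') (at b within X)"
    and cont: "continuous (at b within X) (\<lambda>s. G s y')"
    and y: "(y has_vector_derivative y') (at b within X)" and b: "b \<in> X"
  shows "((\<lambda>s. G s (y s)) has_vector_derivative g' + G b y') (at b within X)"
proof -
  have "((\<lambda>s. G s (y s - y b)) has_vector_derivative G b y') (at b within X)"
    unfolding has_vector_derivative_def has_derivative_within_alt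
  proof (intro conjI allI impI)
    fix e :: real assume e: "0 < e"
    define e1 where "e1 = e / (2 * (M + 1))"
    have e1: "0 < e1" "M * e1 \<le> e / 2" using e M by (auto simp: e1_def field_simps)
    obtain d1 where d1: "0 < d1" "\<And>s. s \<in> X \<Longrightarrow> norm (s - b) < d1 \<Longrightarrow>
        norm (y s - y b - (s - b) *\<^sub>R y') \<le> e1 * norm (s - b)"
      using y e1(1) unfolding has_vector_derivative_def has_derivative_within_alt by blast
    obtain d2 where d2: "0 < d2" "\<And>s. s \<in> X \<Longrightarrow> dist s b < d2 \<Longrightarrow> dist (G s y') (G b y') < e / 2"
      using cont half_gt_zero[OF e] unfolding continuous_within_eps_delta by metis
    show "\<exists>d>0. \<forall>s\<in>X. norm (s - b) < d \<longrightarrow>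
        norm (G s (y s - y b) - G b (y b - y b) - (s - b) *\<^sub>R G b y') \<le> e * norm (s - b)"
    proof (intro exI[of _ "min d1 d2"] conjI ballI impI)
      fix s assume s: "s \<in> X" "norm (s - b) < min d1 d2"
      have "G s (y s - y b) - G b (y b - y b) - (s - b) *\<^sub>R G b y'
          = G s (y s - y b - (s - b) *\<^sub>R y') + (s - b) *\<^sub>R (G s y' - G b y')"
        using lin[OF s(1)] lin[OF b] by (simp add: linear_simps scaleR_diff_right)
      also have "norm \<dots> \<le> M * (e1 * norm (s - b)) + norm (s - b) * (e / 2)"
      proof (rule norm_triangle_mono)
        show "norm (G s (y s - y b - (s - b) *\<^sub>R y')) \<le> M * (e1 * norm (s - b))"
          using bound[OF s(1)] d1(2)[OF s(1)] s(2) M by (meson mult_left_mono order_trans min_less_iff_conj)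
        show "norm ((s - b) *\<^sub>R (G s y' - G b y')) \<le> norm (s - b) * (e / 2)"
          unfolding norm_scaleR real_norm_def
          using d2(2)[OF s(1)] s(2) by (intro mult_left_mono) (auto simp: dist_norm)
      qed
      also have "\<dots> \<le> e * norm (s - b)"
        using mult_right_mono[OF e1(2), of "norm (s - b)"] by (simp add: mult_ac)
      finally show "norm (G s (y s - y b) - G b (y b - y b) - (s - b) *\<^sub>R G b y') \<le> e * norm (s - b)" .
    qed (use d1 d2 in auto)
  qed (rule bounded_linear_scaleR_left)
  from has_vector_derivative_add[OF G this]
  show ?thesis
  proof (rule has_vector_derivative_transform[OF b, rotated])
    show "G s (y s) = G s (y b) + G s (y s - y b)" if "s \<in> X" for s
      using lin[OF that] by (simp add: linear_simps)
  qed
qed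

section \<open>Generator of the extended family and independence of the splitting point\<close>

context semigroup_extension
begin

lemma G_cont: "continuous_on {0..a} (\<lambda>s. G s x)"
  by (intro indefinite_integral_continuous_1 integrable_continuous_real semigroup_continuous[OF P])

lemma H_cont: "continuous_on {0..r} (\<lambda>s. H s x)"
  by (intro indefinite_integral_continuous_1 integrable_continuous_real semigroup_continuous[OF S])

lemma G_min_cont: "continuous_on {0..a + r} (\<lambda>s. G (min s a) x)"
  by (rule continuous_on_compose2[OF G_cont]) (use a in \<open>auto intro!: continuous_intros\<close>)

lemma P_int: "b \<le> a \<Longrightarrow> (\<lambda>s. P s x) integrable_on {0..b}"
  by (intro integrable_continuous_real continuous_on_subset[OF semigroup_continuous[OF P]]) auto

lemma integral_P_min:
  assumes "0 \<le> s"
  shows "integral {0..s} (\<lambda>s. P (min s a) x) = G (min s a) x + u s *\<^sub>R P a x"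
proof (cases "s \<le> a")
  case True
  then have "integral {0..s} (\<lambda>s. P (min s a) x) = G s x"
    by (intro integral_cong) auto
  then show ?thesis using True by simp
next
  case False
  have "(\<lambda>s. P (min s a) x) integrable_on {0..s}"
    by (intro integrable_continuous_real P_min_cont) auto
  then have "integral {0..s} (\<lambda>s. P (min s a) x)
      = integral {0..a} (\<lambda>s. P (min s a) x) + integral {a..s} (\<lambda>s. P (min s a) x)"
    using Henstock_Kurzweil_Integration.integral_combine[of 0 a s "\<lambda>s. P (min s a) x"] False a by simp
  also have "integral {0..a} (\<lambda>s. P (min s a) x) = G a x"
    by (intro integral_cong) auto
  also have "integral {a..s} (\<lambda>s. P (min s a) x) = integral {a..s} (\<lambda>_. P a x)"
    by (intro integral_cong) auto
  finally show ?thesis using False by simp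
qed

text \<open>\<open>s *\<^sub>R v\<close> is the primitive of the constant \<open>v\<close>, so the
  convolution amounts to integrating \<open>k\<close> twice.\<close>

lemma vconv_ident:
  assumes t: "t \<in> {0..a + r}"
  shows "vconv k (\<lambda>s. s *\<^sub>R v) t = smul (integral {0..t} K) v"
proof -
  have "vconv k (\<lambda>s. s *\<^sub>R v) t = vconv k (\<lambda>s. integral {0..s} (\<lambda>_. v)) t"
    by (intro vconv_cong) auto
  also have "\<dots> = integral {0..t} (vconv k (\<lambda>_. v))"
    using integral_vconv_right[OF k _ t] by simp
  also have "\<dots> = integral {0..t} (\<lambda>s. smul (K s) v)"
    using t by (intro integral_cong vconv_const k_int) auto
  also have "\<dots> = smul (integral {0..t} K) v"
    using t by (intro integral_smul_const integrable_continuous_real continuous_on_subset[OF K_cont]) auto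
  finally show ?thesis .
qed

lemma Pa_diff_smul: "P a (y - smul c x) = P a y - smul c (P a x)"
  using semigroup_smul[OF P, of a] a by (simp add: linear_simps(2)[OF Pa_linear])

text \<open>Beyond \<open>a\<close> the primitive of the continued \<open>P\<close> grows by
  \<open>u s *\<^sub>R P a x\<close>; the convolution of this part with \<open>k\<close> is exactly
  what \<open>integral_R_parts\<close> subtracts.\<close>

lemma integral_R:
  assumes t: "t \<in> {0..a + r}"
  shows "integral {0..t} (\<lambda>s. R s x)
    = vconv k (\<lambda>s. G (min s a) x) t + P a (H (u t) x) + vconv pa (\<lambda>s. H s x) (u t)"
proof -
  have "integral {0..t} (vconv k (\<lambda>s. P (min s a) x))
      = vconv k (\<lambda>s. integral {0..s} (\<lambda>s. P (min s a) x)) t"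
    by (intro integral_vconv_right[OF k P_min_cont t]) auto
  also have "\<dots> = vconv k (\<lambda>s. G (min s a) x + u s *\<^sub>R P a x) t"
    by (intro vconv_cong integral_P_min) auto
  also have "\<dots> = vconv k (\<lambda>s. G (min s a) x) t + vconv k (\<lambda>s. u s *\<^sub>R P a x) t"
    using t by (intro vconv_add[OF k G_min_cont]) (auto intro!: continuous_intros)
  also have "vconv k (\<lambda>s. u s *\<^sub>R P a x) t = vconv k (\<lambda>s. s *\<^sub>R P a x) (u t)"
    using a t by (intro vconv_delay[OF k]) (auto intro!: continuous_intros)
  also have "\<dots> = smul (integral {0..u t} K) (P a x)"
    using u_in[OF t] a by (intro vconv_ident) auto
  finally show ?thesis
    unfolding integral_R_parts[OF t] Pa_diff_smul
    by (simp add: integral_vconv_right[OF pa semigroup_continuous[OF S] u_in[OF t]])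
qed

text \<open>The scalar identity left over after applying \<open>A\<close>. The primitive of
  \<open>p\<close> is itself stopped at \<open>a\<close>, plus the primitive of \<open>pa\<close>
  delayed by \<open>a\<close>. Convolving the latter with \<open>k\<close> gives the integral of
  \<open>convolution k pa\<close> up to \<open>u t\<close>, where commutativity shifts the
  integration onto \<open>k\<close>.\<close>

lemma integral_convolution_split:
  assumes t: "t \<in> {0..a + r}"
  shows "integral {0..t} (convolution k p)
    = convolution k (\<lambda>s. Kp (min s a)) t + convolution pa K (u t)"
proof -
  interpret scalar: banach_space_over "(*) :: 's \<Rightarrow> 's \<Rightarrow> 's" by (rule banach_space_over_times)
  have conv: "convolution f g = scalar.vconv f g" for f g :: "real \<Rightarrow> 's"
    by (intro ext) (simp add: convolution_def scalar.vconv_def)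
  define L where "L = (\<lambda>w. integral {0..w} pa)"
  have L: "continuous_on {0..r} L"
    unfolding L_def by (intro indefinite_integral_continuous_1 pa_int) simp
  have split: "Kp s = Kp (min s a) + L (u s)" if "s \<le> a + r" for s
  proof (cases "s \<le> a")
    case False
    have "L (u s) = integral {a..s} p"
      using False integral_shift_Icc_real[of 0 "s - a" p a] by (simp add: L_def o_def)
    then show ?thesis
      using Henstock_Kurzweil_Integration.integral_combine[OF _ _ p_int[OF that], of a] a False by simp
  qed (simp add: L_def)
  have "integral {0..t} (convolution k p) = scalar.vconv k Kp t"
    using integral_convolution_right[OF k p t] by (simp add: conv)
  also have "\<dots> = scalar.vconv k (\<lambda>s. Kp (min s a) + L (u s)) t"
    using t by (intro scalar.vconv_cong split) auto
  also have "\<dots> = scalar.vconv k (\<lambda>s. Kp (min s a)) t + scalar.vconv k (\<lambda>s. L (u s)) t"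
  proof (rule scalar.vconv_add[OF k])
    show "continuous_on {0..a + r} (\<lambda>s. Kp (min s a))"
      by (rule continuous_on_compose2[OF Kp_cont]) (use a r in \<open>auto intro!: continuous_intros\<close>)
    show "continuous_on {0..a + r} (\<lambda>s. L (u s))"
      by (rule continuous_on_compose2[OF L]) (use r in \<open>auto intro!: continuous_intros\<close>)
  qed (use t in auto)
  also have "scalar.vconv k (\<lambda>s. L (u s)) t = scalar.vconv k L (u t)"
    using a t by (intro scalar.vconv_delay[OF k L]) (auto simp: L_def)
  also have "\<dots> = integral {0..u t} (convolution k pa)"
    using integral_convolution_right[OF _ pa u_in[OF t], of k] k'[of r] a by (simp add: L_def conv)
  also have "\<dots> = integral {0..u t} (convolution pa k)"
    by (intro integral_cong convolution_commute)
  also have "\<dots> = convolution pa K (u t)"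
    using integral_convolution_right[OF pa _ u_in[OF t], of k] k'[of r] a by simp
  finally show ?thesis by (simp add: conv)
qed

text \<open>\<open>A\<close> sends each term of \<open>integral_R\<close> to the matching term of
  \<open>R_eq\<close>, minus a scalar convolution times \<open>x\<close> for the two convolution
  terms. For the middle term the scalar part \<open>K (u t)\<close> stays inside \<open>P a\<close>,
  where \<open>R_eq\<close> has it.\<close>

lemma R_generator:
  assumes t: "t \<in> {0..a + r}"
  shows "integral {0..t} (\<lambda>s. R s x) \<in> D \<and>
    A (integral {0..t} (\<lambda>s. R s x)) = R t x - smul (integral {0..t} (convolution k p)) x"
proof -
  note sub = operator_domain[OF S]
  have 1: "vconv k (\<lambda>s. G (min s a) x) t \<in> D \<and> A (vconv k (\<lambda>s. G (min s a) x) t)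
      = vconv k (\<lambda>s. P (min s a) x) t - smul (convolution k (\<lambda>s. Kp (min s a)) t) x"
  proof -
    have AG: "A (G (min s a) x) = P (min s a) x - smul (Kp (min s a)) x" if "s \<in> {0..a + r}" for s
      using that a by (intro semigroup_generator[OF P]) auto
    have c: "continuous_on {0..a + r} (\<lambda>s. Kp (min s a))"
      by (rule continuous_on_compose2[OF Kp_cont]) (use a r in \<open>auto intro!: continuous_intros\<close>)
    have "vconv k (\<lambda>s. G (min s a) x) t \<in> D \<and>
        A (vconv k (\<lambda>s. G (min s a) x) t) = vconv k (\<lambda>s. A (G (min s a) x)) t"
    proof (rule closed_operator_vconv[OF semigroup_closed[OF S] k G_min_cont])
      show "continuous_on {0..a + r} (\<lambda>s. A (G (min s a) x))"
        by (subst continuous_on_cong[OF refl AG])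
          (auto intro!: continuous_on_diff P_min_cont smul.continuous_on c)
    qed (use t a in \<open>auto intro!: semigroup_integral_domain[OF P]\<close>)
    \<comment> \<open>The difference is written as a sum with \<open>- x\<close> so that
      \<open>vconv_add\<close> and \<open>vconv_separable\<close> apply.\<close>
    moreover have "vconv k (\<lambda>s. A (G (min s a) x)) t = vconv k (\<lambda>s. P (min s a) x + smul (Kp (min s a)) (- x)) t"
      using t by (intro vconv_cong) (auto simp: AG)
    moreover have "\<dots> = vconv k (\<lambda>s. P (min s a) x) t + vconv k (\<lambda>s. smul (Kp (min s a)) (- x)) t"
      using t by (intro vconv_add[OF k P_min_cont] smul.continuous_on c continuous_on_const) auto
    moreover have "vconv k (\<lambda>s. smul (Kp (min s a)) (- x)) t = smul (convolution k (\<lambda>s. Kp (min s a)) t) (- x)"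
      using t by (intro vconv_separable[OF k c]) auto
    ultimately show ?thesis by simp
  qed
  have 2: "vconv pa (\<lambda>s. H s x) (u t) \<in> D \<and>
      A (vconv pa (\<lambda>s. H s x) (u t)) = vconv pa (\<lambda>s. S s x) (u t) - smul (convolution pa K (u t)) x"
  proof -
    have AH: "A (H s x) = S s x - smul (K s) x" if "s \<in> {0..r}" for s
      using that by (intro semigroup_generator[OF S])
    have c: "continuous_on {0..r} K"
      by (rule continuous_on_subset[OF K_cont]) (use a in auto)
    have "vconv pa (\<lambda>s. H s x) (u t) \<in> D \<and>
        A (vconv pa (\<lambda>s. H s x) (u t)) = vconv pa (\<lambda>s. A (H s x)) (u t)"
    proof (rule closed_operator_vconv[OF semigroup_closed[OF S] pa H_cont])
      show "continuous_on {0..r} (\<lambda>s. A (H s x))"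
        by (subst continuous_on_cong[OF refl AH])
          (auto intro!: continuous_on_diff semigroup_continuous[OF S] smul.continuous_on c)
    qed (use u_in[OF t] in \<open>auto intro!: semigroup_integral_domain[OF S]\<close>)
    moreover have "vconv pa (\<lambda>s. A (H s x)) (u t) = vconv pa (\<lambda>s. S s x + smul (K s) (- x)) (u t)"
      using u_in[OF t] by (intro vconv_cong) (auto simp: AH)
    moreover have "\<dots> = vconv pa (\<lambda>s. S s x) (u t) + vconv pa (\<lambda>s. smul (K s) (- x)) (u t)"
      using u_in[OF t] by (intro vconv_add[OF pa semigroup_continuous[OF S]] smul.continuous_on c continuous_on_const) auto
    moreover have "vconv pa (\<lambda>s. smul (K s) (- x)) (u t) = smul (convolution pa K (u t)) (- x)"
      using u_in[OF t] by (intro vconv_separable[OF pa c]) auto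
    ultimately show ?thesis by simp
  qed
  have H: "H (u t) x \<in> D" "A (H (u t) x) = S (u t) x - smul (K (u t)) x"
    using semigroup_integral_domain[OF S u_in[OF t]] semigroup_generator[OF S u_in[OF t]] by auto
  have 3: "P a (H (u t) x) \<in> D \<and> A (P a (H (u t) x)) = P a (S (u t) x - smul (K (u t)) x)"
    using semigroup_domain[OF P _ H(1), of a] semigroup_commute[OF P _ H(1), of a] a H(2) by simp
  show ?thesis
    unfolding integral_R[OF t] R_eq[OF t] integral_convolution_split[OF t] scale_left_distrib
    using 1 2 3 by (simp add: operator_add[OF S] subspace_add[OF sub])
qed

lemma R_semigroup: "local_convoluted_semigroup smul {0..a + r} (convolution k p) D A R"
  unfolding local_convoluted_semigroup_def
proof (intro conjI ballI allI)
  show "time_interval {0..a + r}"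
    unfolding time_interval_def using a r by (intro disjI2 exI[of _ "a + r"]) auto
  show "locally_integrable_on (convolution k p) {0..a + r}"
    unfolding locally_integrable_on_def
    using absolutely_integrable_convolution(1)[OF k p]
    by (auto intro: set_integrable_subset fmeasurableD lmeasurable_compact)
  show "closed_linear_operator smul D A" by (rule semigroup_closed[OF S])
qed (use R_linear R_smul R_cont R_commute R_generator in auto)

text \<open>The integral of \<open>R\<close> with the splitting point as a variable
  \<open>b\<close>, after all integrations have been put on \<open>k\<close> and \<open>p\<close>.
  The integrands do not involve \<open>b\<close>, so moving \<open>b\<close> affects only the limits
  and the middle term.\<close>

definition J :: "real \<Rightarrow> real \<Rightarrow> 'a \<Rightarrow> 'a" where
  "J b t x = integral {0..b} (\<lambda>s. smul (K (t - s)) (P s x))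
    + (P b (H (t - b) x) - smul (Kp b) (H (t - b) x))
    + integral {b..t} (\<lambda>s. smul (Kp s) (S (t - s) x))"

text \<open>For \<open>t \<le> a\<close> the effective splitting point is \<open>t\<close>, where
  all but the first part of \<open>J\<close> vanish.\<close>

lemma integral_R_J:
  assumes t: "t \<in> {0..a + r}"
  shows "integral {0..t} (\<lambda>s. R s x) = J (min t a) t x"
proof -
  have Kabs: "K absolutely_integrable_on {0..a + r}"
    by (intro absolutely_integrable_continuous_real K_cont)
  have left: "integral {0..t} (vconv k (\<lambda>s. P (min s a) x)) = vconv K (\<lambda>s. P (min s a) x) t"
    by (intro integral_vconv_left[OF k P_min_cont t]) auto
  show ?thesis
  proof (cases "t \<le> a")
    case True
    have "vconv K (\<lambda>s. P (min s a) x) t = integral {0..t} (\<lambda>s. smul (K (t - s)) (P s x))"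
      unfolding vconv_def using True by (intro integral_cong) auto
    then show ?thesis
      using True t linear_simps(3)[OF Pa_linear] linear_simps(3)[OF semigroup_bounded_linear[OF P, of t]]
      by (simp add: integral_R_parts left J_def)
  next
    case False
    define v where "v = t - a"
    have v: "v \<in> {0..r}" "t = a + v" "u t = v" "min t a = a" using False t by (auto simp: v_def)
    have Sv: "continuous_on {0..v} (\<lambda>s. S s x)"
      by (rule continuous_on_subset[OF semigroup_continuous[OF S]]) (use v in auto)
    have Kpv: "continuous_on {0..v} (\<lambda>s. Kp (t - s))"
      by (rule continuous_on_compose2[OF Kp_cont]) (use v a in \<open>auto intro!: continuous_intros\<close>)
    have "integral {0..v} (vconv pa (\<lambda>s. S s x)) = vconv (\<lambda>s. integral {0..s} pa) (\<lambda>s. S s x) v"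
      by (rule integral_vconv_left[OF pa semigroup_continuous[OF S] v(1)])
    \<comment> \<open>The primitive of \<open>pa\<close> is a shift of \<open>Kp\<close> minus the
      constant \<open>Kp a\<close>; this constant produces the term with \<open>Kp b\<close> in
      \<open>J\<close>.\<close>
    also have "\<dots> = integral {0..v} (\<lambda>s. smul (Kp (t - s)) (S s x) - smul (Kp a) (S s x))"
      unfolding vconv_def
    proof (rule integral_cong)
      fix s assume s: "s \<in> {0..v}"
      have "integral {0..v - s} pa = integral {a..t - s} p"
        using integral_shift_Icc_real[of 0 "v - s" p a] v by (simp add: o_def algebra_simps)
      moreover have "Kp (t - s) = Kp a + integral {a..t - s} p"
        using Henstock_Kurzweil_Integration.integral_combine[OF _ _ p_int, of a "t - s"] a s v
        by simp
      ultimately have "integral {0..v - s} pa = Kp (t - s) - Kp a" by simp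
      then show "smul (integral {0..v - s} pa) (S s x) = smul (Kp (t - s)) (S s x) - smul (Kp a) (S s x)"
        by (simp add: smul.diff_left)
    qed
    also have "\<dots> = integral {0..v} (\<lambda>s. smul (Kp (t - s)) (S s x)) - integral {0..v} (\<lambda>s. smul (Kp a) (S s x))"
      by (intro integral_diff integrable_continuous_real smul.continuous_on Kpv Sv continuous_on_const)
    also have "integral {0..v} (\<lambda>s. smul (Kp a) (S s x)) = smul (Kp a) (H v x)"
      using integral_linear[OF integrable_continuous_real[OF Sv] smul.bounded_linear_right, of "Kp a"]
      by (simp add: o_def)
    also have "integral {0..v} (\<lambda>s. smul (Kp (t - s)) (S s x)) = integral {a..t} (\<lambda>s. smul (Kp s) (S (t - s) x))"
      using integral_reflect_Icc[of 0 v "\<lambda>s. smul (Kp s) (S (t - s) x)" t] v by simp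
    finally have 1: "integral {0..v} (vconv pa (\<lambda>s. S s x))
      = integral {a..t} (\<lambda>s. smul (Kp s) (S (t - s) x)) - smul (Kp a) (H v x)" .
    \<comment> \<open>The last summand, from the constant tail of \<open>P\<close>, cancels against
      the correction in \<open>integral_R_parts\<close>.\<close>
    have 2: "vconv K (\<lambda>s. P (min s a) x) t
        = integral {0..a} (\<lambda>s. smul (K (t - s)) (P s x)) + smul (integral {0..v} K) (P a x)"
      using vconv_P_min[OF Kabs v(1)] v(2) by simp
    show ?thesis
      unfolding integral_R_parts[OF t] left v(3,4) 1 2 Pa_diff_smul J_def
      using v(2) by simp
  qed
qed

text \<open>\<open>J b t x\<close> and \<open>A (G b (H (t - b) x))\<close> differ by integrals; the derivative of
  \<open>G b (H (t - b) x)\<close> in \<open>b\<close> only contains terms to which \<open>A\<close> can be applied.\<close>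

lemma J_independent:
  assumes b: "0 \<le> b1" "b1 \<le> b2" "b2 \<le> a" "b2 \<le> t" "t - b1 \<le> r"
  shows "J b1 t x = J b2 t x"
proof -
  note sub = operator_domain[OF S]
  define y where "y b = H (t - b) x" for b
  have tb: "t - s \<in> {0..r}" if "s \<in> {b1..b2}" for s using that b by auto
  have sa: "s \<in> {0..a}" if "s \<in> {b1..b2}" for s using that b by auto
  have y: "y s \<in> D" "A (y s) = S (t - s) x - smul (K (t - s)) x" if "s \<in> {b1..b2}" for s
    unfolding y_def
    using semigroup_integral_domain[OF S tb[OF that]] semigroup_generator[OF S tb[OF that]] by auto
  have G: "G s z \<in> D" "A (G s z) = P s z - smul (Kp s) z" if "s \<in> {b1..b2}" for s z
    using semigroup_integral_domain[OF P sa[OF that]] semigroup_generator[OF P sa[OF that]] by auto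
  \<comment> \<open>\<open>P\<close> commutes with \<open>A\<close> on \<open>D\<close>, and
    closedness carries this over to its integral.\<close>
  have GA: "G s (A z) = A (G s z)" if "s \<in> {b1..b2}" "z \<in> D" for s z
  proof -
    have "((\<lambda>q. P q (A z)) has_integral G s (A z)) {0..s}"
      using P_int[of s "A z"] sa[OF that(1)] by (auto simp: has_integral_integral)
    then have "((\<lambda>q. A (P q z)) has_integral G s (A z)) {0..s}"
      by (rule has_integral_eq[rotated]) (use sa[OF that(1)] semigroup_commute[OF P _ that(2)] in auto)
    moreover have "((\<lambda>q. P q z) has_integral G s z) {0..s}"
      using P_int[of s z] sa[OF that(1)] by (auto simp: has_integral_integral)
    ultimately have "G s z \<in> D \<and> A (G s z) = G s (A z)"
      using sa[OF that(1)] semigroup_domain[OF P _ that(2)]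
      by (intro closed_operator_has_integral[OF semigroup_closed[OF S]]) auto
    then show ?thesis by simp
  qed
  \<comment> \<open>With \<open>G\<close> as a convolution with kernel 1, its boundedness and
    homogeneity are instances of the lemmas on \<open>vconv\<close>.\<close>
  have G_vconv: "G s z = vconv (\<lambda>_. 1) (\<lambda>s. P s z) s" for s z
    by (simp add: vconv_def)
  have one: "(\<lambda>_. 1 :: 's) absolutely_integrable_on {0..a}"
    by (intro absolutely_integrable_continuous_real continuous_on_const)
  have G_lin: "bounded_linear (G s)" if "s \<in> {0..a}" for s
    unfolding G_vconv using that
    by (intro bounded_linear_vconv[OF one]) (auto intro: semigroup_bounded_linear[OF P] semigroup_continuous[OF P])
  have "bounded ((\<lambda>s. G s z) ` {0..a})" for z
    by (intro compact_imp_bounded compact_continuous_image G_cont) auto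
  then obtain M where M: "0 \<le> M" "\<And>s z. s \<in> {0..a} \<Longrightarrow> norm (G s z) \<le> M * norm z"
    using uniform_boundedness_principle[of "{0..a}" G] G_lin by metis
  have G_smul: "G s (smul c z) = smul c (G s z)" if "s \<in> {0..a}" for s c z
  proof -
    have "G s (smul c z) = vconv (\<lambda>_. 1) (\<lambda>s. smul c (P s z)) s"
      unfolding G_vconv using that by (intro vconv_cong semigroup_smul[OF P]) auto
    also have "\<dots> = smul c (G s z)"
      unfolding G_vconv using that by (intro vconv_smul[OF one] semigroup_continuous[OF P]) auto
    finally show ?thesis .
  qed
  \<comment> \<open>The product rule yields \<open>P s (y s) - G s (S (t - s) x)\<close>. By the
    generator identities for \<open>P\<close> and \<open>S\<close> both terms contain
    \<open>A (G s (y s))\<close>, which cancels and leaves \<open>?q s\<close>.\<close>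
  let ?q = "\<lambda>s. smul (Kp s) (y s) - smul (K (t - s)) (G s x)"
  have deriv: "((\<lambda>s. G s (y s)) has_vector_derivative ?q s) (at s within {b1..b2})"
    if s: "s \<in> {b1..b2}" for s
  proof -
    have "((\<lambda>s. G s (y s)) has_vector_derivative P s (y s) + G s (- S (t - s) x)) (at s within {b1..b2})"
    proof (rule has_vector_derivative_strong_product[where M = M and G = "\<lambda>s z. G s z" and y = y
          and b = s and g' = "P s (y s)" and y' = "- S (t - s) x"])
      show "((\<lambda>q. G q (y s)) has_vector_derivative P s (y s)) (at s within {b1..b2})"
        by (rule has_vector_derivative_within_subset[OF
              integral_has_vector_derivative[OF semigroup_continuous[OF P] sa[OF s]]])
          (use sa in auto)
      show "continuous (at s within {b1..b2}) (\<lambda>q. G q (- S (t - s) x))"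
        using G_cont sa s by (meson continuous_on_eq_continuous_within continuous_on_subset subsetI)
      have chain1: "((\<lambda>s. t - s) has_vector_derivative - 1) (at s within {b1..b2})"
        by (auto intro!: derivative_eq_intros)
      have chain2: "((\<lambda>w. H w x) has_vector_derivative S (t - s) x) (at (t - s) within (\<lambda>s. t - s) ` {b1..b2})"
        by (rule has_vector_derivative_within_subset[OF
              integral_has_vector_derivative[OF semigroup_continuous[OF S] tb[OF s]]])
          (use tb in auto)
      show "(y has_vector_derivative - S (t - s) x) (at s within {b1..b2})"
        using vector_diff_chain_within[OF chain1 chain2] by (simp add: o_def y_def[abs_def])
    qed (use M sa s G_lin in auto)
    moreover have "P s (y s) + G s (- S (t - s) x) = ?q s"
    proof -
      have "S (t - s) x = A (y s) + smul (K (t - s)) x"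
        using y(2)[OF s] by simp
      then have "G s (S (t - s) x) = A (G s (y s)) + smul (K (t - s)) (G s x)"
        using GA[OF s y(1)[OF s]] G_smul[OF sa[OF s]] by (simp add: linear_simps[OF G_lin[OF sa[OF s]]])
      then show ?thesis
        using G(2)[OF s, of "y s"] by (simp add: linear_simps[OF G_lin[OF sa[OF s]]])
    qed
    ultimately show ?thesis by simp
  qed
  have int: "(?q has_integral G b2 (y b2) - G b1 (y b1)) {b1..b2}"
    by (rule fundamental_theorem_of_calculus[OF b(2)]) (rule deriv)
  have contS: "continuous_on {b1..t} (\<lambda>s. smul (Kp s) (S (t - s) x))"
  proof (rule smul.continuous_on)
    show "continuous_on {b1..t} Kp"
      by (rule continuous_on_subset[OF Kp_cont]) (use b in auto)
    show "continuous_on {b1..t} (\<lambda>s. S (t - s) x)"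
      by (rule continuous_on_compose2[OF semigroup_continuous[OF S]]) (use b in \<open>auto intro!: continuous_intros\<close>)
  qed
  have contP: "continuous_on {0..b2} (\<lambda>s. smul (K (t - s)) (P s x))"
  proof (rule smul.continuous_on)
    show "continuous_on {0..b2} (\<lambda>s. K (t - s))"
      by (rule continuous_on_compose2[OF K_cont]) (use b in \<open>auto intro!: continuous_intros\<close>)
    show "continuous_on {0..b2} (\<lambda>s. P s x)"
      by (rule continuous_on_subset[OF semigroup_continuous[OF P]]) (use b in auto)
  qed
  note intS = integrable_continuous_real[OF contS] and intP = integrable_continuous_real[OF contP]
  have intS': "(\<lambda>s. smul (Kp s) (S (t - s) x)) integrable_on {b1..b2}"
    and intP': "(\<lambda>s. smul (K (t - s)) (P s x)) integrable_on {b1..b2}"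
    using b by (auto intro: integrable_subinterval_real[OF intS] integrable_subinterval_real[OF intP])
  let ?IS = "\<lambda>c d. integral {c..d} (\<lambda>s. smul (Kp s) (S (t - s) x))"
  let ?IP = "\<lambda>c d. integral {c..d} (\<lambda>s. smul (K (t - s)) (P s x))"
  have "((\<lambda>s. smul (Kp s) (S (t - s) x) - smul (K (t - s)) (P s x)) has_integral ?IS b1 b2 - ?IP b1 b2) {b1..b2}"
    using intS' intP' by (intro has_integral_diff) (simp_all add: has_integral_integral)
  \<comment> \<open>The two multiples of \<open>x\<close> with factor
    \<open>Kp s * K (t - s)\<close> cancel, which leaves the integrands of \<open>J\<close>.\<close>
  moreover have "smul (Kp s) (S (t - s) x) - smul (K (t - s)) (P s x) = A (?q s)" if s: "s \<in> {b1..b2}" for s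
    unfolding operator_diff[OF S subspace_scale[OF sub y(1)[OF s]] subspace_scale[OF sub G(1)[OF s]]]
      operator_smul[OF S y(1)[OF s]] operator_smul[OF S G(1)[OF s]] y(2)[OF s] G(2)[OF s]
    by (simp add: smul.diff_right mult.commute)
  ultimately have "((\<lambda>s. A (?q s)) has_integral ?IS b1 b2 - ?IP b1 b2) {b1..b2}"
    by (rule has_integral_eq[rotated])
  then have "A (G b2 (y b2) - G b1 (y b1)) = ?IS b1 b2 - ?IP b1 b2"
    using closed_operator_has_integral[OF semigroup_closed[OF S] int] y(1) G(1)
      subspace_diff[OF sub] subspace_scale[OF sub] by simp
  \<comment> \<open>At each end point \<open>A\<close> yields the middle part of \<open>J\<close>;
    its change thus balances the change of the limits of integration.\<close>
  moreover have "A (G b2 (y b2) - G b1 (y b1))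
      = (P b2 (y b2) - smul (Kp b2) (y b2)) - (P b1 (y b1) - smul (Kp b1) (y b1))"
    using b by (simp add: operator_diff[OF S] G)
  moreover have "?IP 0 b2 = ?IP 0 b1 + ?IP b1 b2"
    using Henstock_Kurzweil_Integration.integral_combine[OF b(1,2) intP] by simp
  moreover have "?IS b1 t = ?IS b1 b2 + ?IS b2 t"
    using Henstock_Kurzweil_Integration.integral_combine[OF b(2,4) intS] by simp
  ultimately show ?thesis
    unfolding J_def y_def by (simp add: algebra_simps)
qed

text \<open>The body of \<open>J\<close> mentions neither \<open>a\<close> nor \<open>r\<close>, so
  both instances of the locale share it. Hence the two extensions have equal integrals over every
  \<open>{0..s}\<close>, and continuity gives equality of values.\<close>

lemma R_independent:
  assumes "0 < a'" "a' \<le> a" "0 < r'" "r' \<le> r" and t: "t \<in> {0..a' + r'}"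
  shows "extension k p S P a' t x = R t x"
proof -
  interpret small: semigroup_extension smul k p D A S P a' r'
  proof
    show "k absolutely_integrable_on {0..a' + r'}" "p absolutely_integrable_on {0..a' + r'}"
      using assms by (auto intro: k' p')
    show "local_convoluted_semigroup smul {0..r'} k D A S"
      using local_convoluted_semigroup_restrict[OF S] assms by simp
    show "local_convoluted_semigroup smul {0..a'} p D A P"
      using local_convoluted_semigroup_restrict[OF P] assms by simp
  qed (use assms in auto)
  show ?thesis
  proof (rule continuous_eq_if_integral_eq[OF small.R_cont _ _ t])
    show "continuous_on {0..a' + r'} (\<lambda>t. R t x)"
      by (rule continuous_on_subset[OF R_cont]) (use assms in auto)
    fix s assume s: "s \<in> {0..a' + r'}"
    have "J (min s a') s x = J (min s a) s x"
      using s assms by (intro J_independent) auto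
    then show "integral {0..s} (\<lambda>t. extension k p S P a' t x) = integral {0..s} (\<lambda>t. R t x)"
      using small.integral_R_J[OF s] integral_R_J[of s] s assms by simp
  qed (use assms in auto)
qed

end

subsection \<open>Iterating the extension\<close>

lemma absolutely_integrable_conv_power:
  assumes "k absolutely_integrable_on {0..b}"
  shows "conv_power k m absolutely_integrable_on {0..b}"
  using assms by (induction k m rule: conv_power.induct) (auto intro: absolutely_integrable_convolution(1))

lemma Icc_subset_Ico: "ereal b < \<sigma> \<Longrightarrow> {0..b} \<subseteq> Ico \<sigma>"
  by (auto simp: Ico_def intro: le_less_trans[of "ereal _" "ereal b"])

context banach_space_over
begin

lemma local_convoluted_semigroup_cong:
  assumes S: "local_convoluted_semigroup smul {0..b} k D A S"
    and eq: "\<And>t x. t \<in> {0..b} \<Longrightarrow> S t x = T t x"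
  shows "local_convoluted_semigroup smul {0..b} k D A T"
proof -
  have ST: "S t = T t" if "t \<in> {0..b}" for t using eq[OF that] by (rule ext)
  have "continuous_on {0..b} (\<lambda>t. T t x)" for x
    using semigroup_continuous[OF S, of x] by (rule continuous_on_eq) (rule eq)
  moreover have "integral {0..t} (\<lambda>s. S s x) = integral {0..t} (\<lambda>s. T s x)" if "t \<in> {0..b}" for t x
    using that eq by (intro integral_cong) auto
  ultimately show ?thesis
    using S ST unfolding local_convoluted_semigroup_def by simp
qed

text \<open>All requirements are local in time. Choosing an end point strictly beyond
  \<open>t\<close> makes \<open>{0..b}\<close> and \<open>Ico \<sigma>\<close> coincide near
  \<open>t\<close>, which continuity needs; a compact subset lies below such an end point as
  well.\<close>

lemma local_convoluted_semigroup_Ico: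
  assumes \<sigma>: "0 < \<sigma>"
    and S: "\<And>b. 0 < b \<Longrightarrow> ereal b < \<sigma> \<Longrightarrow> local_convoluted_semigroup smul {0..b} k D A S"
  shows "local_convoluted_semigroup smul (Ico \<sigma>) k D A S"
proof -
  have ex: "\<exists>b. t < b \<and> ereal b < \<sigma>" if "ereal t < \<sigma>" for t
    using ereal_dense2[OF that] by auto
  have ex': "\<exists>b>0. t < b \<and> local_convoluted_semigroup smul {0..b} k D A S" if t: "t \<in> Ico \<sigma>" for t
  proof -
    obtain b where "t < b" "ereal b < \<sigma>" using ex[of t] t by (auto simp: Ico_def)
    then show ?thesis using t S[of b] by (intro exI[of _ b]) (auto simp: Ico_def)
  qed
  have Ico: "Ico \<sigma> \<inter> {..<b} = {0..b} \<inter> {..<b}" if "ereal b < \<sigma>" for b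
    using Icc_subset_Ico[OF that] by (auto simp: Ico_def)
  have "locally_integrable_on k (Ico \<sigma>)"
    unfolding locally_integrable_on_def
  proof (intro allI impI)
    fix C assume C: "compact C \<and> C \<subseteq> Ico \<sigma>"
    show "k absolutely_integrable_on C"
    proof (cases "C = {}")
      case False
      then obtain t where t: "t \<in> C" "\<And>s. s \<in> C \<Longrightarrow> s \<le> t"
        using compact_attains_sup[of C] C by blast
      then obtain b where b: "t < b" "local_convoluted_semigroup smul {0..b} k D A S"
        using ex'[of t] C by blast
      have "C \<subseteq> {0..b}" using t b C by (force simp: Ico_def)
      then show ?thesis
        using b(2) C unfolding local_convoluted_semigroup_def locally_integrable_on_def by blast
    qed simp
  qed
  moreover have "continuous_on (Ico \<sigma>) (\<lambda>t. S t x)" for x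
    unfolding continuous_on_eq_continuous_within
  proof
    fix t assume t: "t \<in> Ico \<sigma>"
    then obtain b where b: "t < b" "ereal b < \<sigma>" using ex[of t] by (auto simp: Ico_def)
    have b0: "0 < b" using b t by (simp add: Ico_def)
    have "at t within Ico \<sigma> = at t within {0..b}"
      by (rule at_within_nhd[of t "{..<b}"]) (use b Ico in auto)
    moreover have "continuous (at t within {0..b}) (\<lambda>t. S t x)"
      using semigroup_continuous[OF S[OF b0 b(2)], of x] t b(1)
      by (simp add: continuous_on_eq_continuous_within Ico_def)
    ultimately show "continuous (at t within Ico \<sigma>) (\<lambda>t. S t x)"
      by (simp add: continuous_within)
  qed
  moreover have "time_interval (Ico \<sigma>)" using \<sigma> by (auto simp: time_interval_def)
  moreover have "closed_linear_operator smul D A"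
  proof -
    have "0 \<in> Ico \<sigma>" using \<sigma> by (simp add: Ico_def zero_ereal_def)
    then show ?thesis using ex'[of 0] semigroup_closed by blast
  qed
  moreover have "bounded_linear (S t) \<and> (\<forall>c x. S t (smul c x) = smul c (S t x)) \<and>
      (\<forall>x\<in>D. S t x \<in> D \<and> A (S t x) = S t (A x)) \<and>
      (\<forall>x. integral {0..t} (\<lambda>s. S s x) \<in> D \<and>
        A (integral {0..t} (\<lambda>s. S s x)) = S t x - smul (integral {0..t} k) x)" if t: "t \<in> Ico \<sigma>" for t
  proof -
    obtain b where b: "t < b" "local_convoluted_semigroup smul {0..b} k D A S"
      using ex'[OF t] by blast
    have "t \<in> {0..b}" using b t by (auto simp: Ico_def)
    then show ?thesis
      using b(2) unfolding local_convoluted_semigroup_def by blast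
  qed
  ultimately show ?thesis
    unfolding local_convoluted_semigroup_def by blast
qed

lemma extended_family_eq_extension:
  "extended_family smul k S \<kappa> (Suc (Suc m)) =
    extension k (conv_power k (Suc m)) S (extended_family smul k S \<kappa> (Suc m)) (real (Suc m) * \<kappa>)"
  by (intro ext) (simp add: extension_def vconv_def)

lemma semigroup_extension_extended_family:
  assumes "0 < \<kappa>" and "k absolutely_integrable_on {0..real (Suc (Suc m)) * \<kappa>}"
    and "local_convoluted_semigroup smul {0..\<kappa>} k D A S"
    and "local_convoluted_semigroup smul {0..real (Suc m) * \<kappa>} (conv_power k (Suc m)) D A
      (extended_family smul k S \<kappa> (Suc m))"
  shows "semigroup_extension smul k (conv_power k (Suc m)) D A S
    (extended_family smul k S \<kappa> (Suc m)) (real (Suc m) * \<kappa>) \<kappa>"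
proof
  have eq: "real (Suc m) * \<kappa> + \<kappa> = real (Suc (Suc m)) * \<kappa>" by (simp add: algebra_simps)
  show "k absolutely_integrable_on {0..real (Suc m) * \<kappa> + \<kappa>}"
    using assms(2) by (simp only: eq)
  then show "conv_power k (Suc m) absolutely_integrable_on {0..real (Suc m) * \<kappa> + \<kappa>}"
    by (rule absolutely_integrable_conv_power)
qed (use assms in auto)

lemma extended_family_semigroup:
  assumes "0 < \<kappa>" and "k absolutely_integrable_on {0..real (Suc m) * \<kappa>}"
    and "local_convoluted_semigroup smul {0..\<kappa>} k D A S"
  shows "local_convoluted_semigroup smul {0..real (Suc m) * \<kappa>} (conv_power k (Suc m)) D A
    (extended_family smul k S \<kappa> (Suc m))"
  using assms(2)
proof (induction m)
  case 0
  then show ?case using assms(3) by simp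
next
  case (Suc m)
  have "real (Suc m) * \<kappa> \<le> real (Suc (Suc m)) * \<kappa>"
    using assms(1) by (intro mult_right_mono) auto
  then have "k absolutely_integrable_on {0..real (Suc m) * \<kappa>}"
    by (intro absolutely_integrable_on_Icc_subset[OF Suc.prems]) auto
  then interpret semigroup_extension smul k "conv_power k (Suc m)" D A S
    "extended_family smul k S \<kappa> (Suc m)" "real (Suc m) * \<kappa>" \<kappa>
    by (intro semigroup_extension_extended_family assms Suc)
  have "real (Suc m) * \<kappa> + \<kappa> = real (Suc (Suc m)) * \<kappa>" by (simp add: algebra_simps)
  then show ?case
    using R_semigroup by (simp only: extended_family_eq_extension conv_power.simps)
qed

text \<open>In the induction step the hypothesis first replaces the inner family for
  \<open>\<kappa>'\<close> by the one for \<open>\<kappa>\<close>; then \<open>R_independent\<close>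
  moves the splitting point from \<open>(m + 1) * \<kappa>'\<close> to
  \<open>(m + 1) * \<kappa>\<close>.\<close>

lemma extended_family_independent:
  assumes "0 < \<kappa>'" "\<kappa>' \<le> \<kappa>" and "k absolutely_integrable_on {0..real (Suc m) * \<kappa>}"
    and "local_convoluted_semigroup smul {0..\<kappa>} k D A S" and "t \<in> {0..real (Suc m) * \<kappa>'}"
  shows "extended_family smul k S \<kappa>' (Suc m) t x = extended_family smul k S \<kappa> (Suc m) t x"
  using assms(3,5)
proof (induction m arbitrary: t x)
  case (Suc m)
  have \<kappa>: "0 < \<kappa>" using assms(1,2) by simp
  have "real (Suc m) * \<kappa> \<le> real (Suc (Suc m)) * \<kappa>"
    using \<kappa> by (intro mult_right_mono) auto
  then have k_abs: "k absolutely_integrable_on {0..real (Suc m) * \<kappa>}"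
    by (intro absolutely_integrable_on_Icc_subset[OF Suc.prems(1)]) auto
  interpret semigroup_extension smul k "conv_power k (Suc m)" D A S
    "extended_family smul k S \<kappa> (Suc m)" "real (Suc m) * \<kappa>" \<kappa>
    by (intro semigroup_extension_extended_family extended_family_semigroup \<kappa> k_abs assms(4) Suc.prems)
  have "extended_family smul k S \<kappa>' (Suc (Suc m)) t x
      = extension k (conv_power k (Suc m)) S (extended_family smul k S \<kappa> (Suc m)) (real (Suc m) * \<kappa>') t x"
    unfolding extended_family_eq_extension
    by (rule extension_cong) (use assms(1) Suc.IH[OF k_abs] in auto)
  also have "\<dots> = R t x"
  proof (rule R_independent)
    show "real (Suc m) * \<kappa>' \<le> real (Suc m) * \<kappa>"
      using assms(2) by (intro mult_left_mono) auto
    show "t \<in> {0..real (Suc m) * \<kappa>' + \<kappa>'}"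
      using Suc.prems(2) by (simp add: algebra_simps)
  qed (use assms(1,2) in auto)
  finally show ?case by (simp only: extended_family_eq_extension)
qed simp

end

section \<open>Gluing the families for all \<open>\<kappa>\<close>\<close>

lemma ereal_divide_less_iff_less_mult:
  fixes N b :: real
  assumes "0 < N" "0 < \<tau>"
  shows "ereal (b / N) < \<tau> \<longleftrightarrow> ereal b < ereal N * \<tau>"
  using assms by (cases \<tau>) (auto simp: field_simps)

theorem theorem4:
  fixes smul :: "'s::{real_normed_field, euclidean_space} \<Rightarrow> 'a::banach \<Rightarrow> 'a"
    and k :: "real \<Rightarrow> 's"
    and S :: "real \<Rightarrow> 'a \<Rightarrow> 'a"
    and D :: "'a set" and A :: "'a \<Rightarrow> 'a"
    and n :: nat and \<tau> :: ereal
  assumes "banach_space_over smul"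
    and "n \<ge> 1" and "0 < \<tau>"
    and "locally_integrable_on k (Ico (ereal (real (n + 1)) * \<tau>))"
    and "local_convoluted_semigroup smul (Ico \<tau>) k D A S"
    and "nondegenerate (Ico \<tau>) S"
  shows "(\<forall>\<kappa>::real. 0 < \<kappa> \<and> ereal \<kappa> < \<tau> \<longrightarrow>
            local_convoluted_semigroup smul {0..real (n + 1) * \<kappa>} (conv_power k (n + 1)) D A
              (extended_family smul k S \<kappa> (n + 1))) \<and>
         (\<exists>T. local_convoluted_semigroup smul (Ico (ereal (real (n + 1)) * \<tau>))
                (conv_power k (n + 1)) D A T \<and>
              (\<forall>\<kappa>::real. 0 < \<kappa> \<and> ereal \<kappa> < \<tau> \<longrightarrow>
                (\<forall>t\<in>{0..real (n + 1) * \<kappa>}. \<forall>x. T t x = extended_family smul k S \<kappa> (n + 1) t x)))"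
proof -
  interpret banach_space_over smul by fact
  define N where "N = real (n + 1)"
  have N: "0 < N" by (simp add: N_def)
  note scale = ereal_divide_less_iff_less_mult[OF N \<open>0 < \<tau>\<close>]
  have k: "k absolutely_integrable_on {0..N * \<kappa>}" if "ereal \<kappa> < \<tau>" for \<kappa>
  proof -
    have "ereal (N * \<kappa>) < ereal N * \<tau>" using that scale[of "N * \<kappa>"] N by simp
    then show ?thesis
      using assms(4) Icc_subset_Ico unfolding locally_integrable_on_def N_def by blast
  qed
  have S: "local_convoluted_semigroup smul {0..\<kappa>} k D A S" if "0 < \<kappa>" "ereal \<kappa> < \<tau>" for \<kappa>
    by (rule local_convoluted_semigroup_restrict[OF assms(5) Icc_subset_Ico[OF that(2)] that(1)])
  have E: "local_convoluted_semigroup smul {0..N * \<kappa>} (conv_power k (n + 1)) D A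
      (extended_family smul k S \<kappa> (n + 1))" if "0 < \<kappa>" "ereal \<kappa> < \<tau>" for \<kappa>
    using extended_family_semigroup[OF that(1) _ S[OF that], of n] k[OF that(2)]
    by (simp add: N_def)
  \<comment> \<open>\<open>t / N\<close> is the smallest \<open>\<kappa>\<close> whose interval
    reaches \<open>t\<close>, so every other admissible choice is larger.\<close>
  define T where "T t = extended_family smul k S (t / N) (n + 1) t" for t
  have T: "T t x = extended_family smul k S \<kappa> (n + 1) t x"
    if \<kappa>: "0 < \<kappa>" "ereal \<kappa> < \<tau>" and t: "t \<in> {0..N * \<kappa>}" for \<kappa> t x
  proof (cases "t = 0")
    case True
    \<comment> \<open>Here the parameter is \<open>\<kappa> = 0\<close>, which the comparison
      excludes; the first formula of the recursion, available as \<open>n \<ge> 1\<close>, is an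
      integral over a point.\<close>
    have "T 0 x = 0"
      using \<open>n \<ge> 1\<close> extended_family_left[of n 0 0 smul k S x] by (simp add: T_def)
    then show ?thesis
      using True local_convoluted_semigroup_0[OF assms(1) E[OF \<kappa>]] by simp
  next
    case False
    have "0 < t / N" "t / N \<le> \<kappa>" using False t N by (auto simp: field_simps)
    moreover have "N * (t / N) = t" using N by simp
    ultimately show ?thesis
      using extended_family_independent[where \<kappa>' = "t / N" and \<kappa> = \<kappa> and m = n] k[OF \<kappa>(2)] S[OF \<kappa>] t
      by (simp add: T_def N_def)
  qed
  have "local_convoluted_semigroup smul (Ico (ereal N * \<tau>)) (conv_power k (n + 1)) D A T"
  proof (rule local_convoluted_semigroup_Ico)
    show "0 < ereal N * \<tau>" using N \<open>0 < \<tau>\<close> by (simp add: ereal_zero_less_0_iff)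
    fix b assume b: "0 < b" "ereal b < ereal N * \<tau>"
    \<comment> \<open>With this parameter the family ends exactly at \<open>b\<close>.\<close>
    then have \<kappa>: "0 < b / N" "ereal (b / N) < \<tau>" using N scale by auto
    have "N * (b / N) = b" using N by simp
    then show "local_convoluted_semigroup smul {0..b} (conv_power k (n + 1)) D A T"
      using local_convoluted_semigroup_cong[OF E[OF \<kappa>] T[OF \<kappa>, symmetric]] by simp
  qed
  then show ?thesis
    using E T unfolding N_def by blast
qed

end
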